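(* Let $N\geq 2$ and $\alpha,\beta\in[1,N-1]$. The following relations hold, respectively in $\mathcal F_{\alpha+\beta}$ and $\mathcal F_{2\alpha}$: (i) for all $n,p\in\mathbb Z$ with $|p-n|\le|\alpha-\beta|+1$, $$(x_1x_2\cdots x_\alpha)^n\star(x_1x_2\cdots x_\beta)^p=q^{\min(\alpha,\beta)(p-n)}\,(x_1x_2\cdots x_\beta)^p\star(x_1x_2\cdots x_\alpha)^n;$$ (ii) for all $n\in\mathbb Z$, $$q^\alpha(x_1\cdots x_\alpha)^{n+1}\star(x_1\cdots x_\alpha)^{n-1}=(x_1\cdots x_\alpha)^n\star(x_1\cdots x_\alpha)^n-(x_1\cdots x_{\alpha+1})^n\star(x_1\cdots x_{\alpha-1})^n .$$
   Context: $q$ is an indeterminate and $\mathcal F_\alpha=\mathbb C(q)(x_1,\dots,x_\alpha)^{S_\alpha}$ is the space of symmetric rational functions in $\alpha$ variables ($\mathcal F_0$ being the constants; for $\alpha=1$ the factor $(x_1\cdots x_{\alpha-1})^n$ is $1\in\mathcal F_0$, and $P\star 1=P$). For $P\in\mathcal F_\alpha$, $P'\in\mathcal F_\beta$, the product $P\star P'\in\mathcal F_{\alpha+\beta}$ is $$P\star P'(x_1,\dots,x_{\alpha+\beta})=\frac1{\alpha!\,\beta!}\,\mathrm{Sym}\left(\frac{P(x_1,\dots,x_\alpha)P'(x_{\alpha+1},\dots,x_{\alpha+\beta})}{\prod_{1\le i\le\alpha<j\le\alpha+\beta}(x_j^{-1}-x_i^{-1})(x_j-qx_i)}\right),$$ where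 $\mathrm{Sym}$ is the sum over all permutations of $x_1,\dots,x_{\alpha+\beta}$. In each product, a monomial such as $(x_1\cdots x_\alpha)^n$ denotes the corresponding element of $\mathcal F_\alpha$. *)

theory Defs
  imports
    "HOL-Library.Poly_Mapping"
    "HOL-Computational_Algebra.Polynomial_Factorial"
    "HOL-Combinatorics.Permutations"
begin

section \<open>The field of rational functions\<close>

text \<open>
  The fraction field of \<^typ>\<open>complex poly\<close> is \<open>\<complex>(q)\<close>.  All the spaces of rational functions in
  finitely many variables live in one ambient field \<open>\<complex>(q)(x\<^sub>0, x\<^sub>1, x\<^sub>2, \<dots>)\<close>, the fraction field of
  the ring of polynomials in countably many variables; a monomial is a finitely supported
  exponent vector, a polynomial a finitely supported family of coefficients indexed by
  monomials.  The variable \<open>x\<^sub>0\<close> is never used.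
\<close>

type_synonym qrat = "complex poly fract"
type_synonym mpoly = "(nat \<Rightarrow>\<^sub>0 nat) \<Rightarrow>\<^sub>0 qrat"
type_synonym ratfun = "mpoly fract"

definition scal :: "qrat \<Rightarrow> ratfun"
  where "scal c = to_fract (Poly_Mapping.single 0 c)"

definition qq :: ratfun
  where "qq = scal (to_fract [:0, 1:])"

definition xvar :: "nat \<Rightarrow> ratfun"
  where "xvar i = to_fract (Poly_Mapping.single (Poly_Mapping.single i 1) 1)"

definition mono_eval :: "(nat \<Rightarrow> ratfun) \<Rightarrow> (nat \<Rightarrow>\<^sub>0 nat) \<Rightarrow> ratfun"
  where "mono_eval y m = (\<Prod>i\<in>Poly_Mapping.keys m. y i ^ Poly_Mapping.lookup m i)"

definition poly_eval :: "(nat \<Rightarrow> ratfun) \<Rightarrow> mpoly \<Rightarrow> ratfun"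
  where "poly_eval y p =
    (\<Sum>m\<in>Poly_Mapping.keys p. scal (Poly_Mapping.lookup p m) * mono_eval y m)"

text \<open>
  \<open>ratfun_eval y r\<close> is \<open>r(y\<^sub>1, y\<^sub>2, \<dots>)\<close>.  It is only meaningful if \<open>r\<close> is a quotient whose
  denominator does not vanish at \<open>y\<close>; this holds for every \<open>r\<close> when the \<open>y\<^sub>i\<close> are pairwise
  distinct variables, the only case used below (see \<open>ratfun_eval_fract\<close> and \<open>ratfun_eval_rename\<close>).
\<close>

definition ratfun_eval :: "(nat \<Rightarrow> ratfun) \<Rightarrow> ratfun \<Rightarrow> ratfun"
  where "ratfun_eval y r =
    (THE v. \<exists>a b. r = Fract a b \<and> poly_eval y b \<noteq> 0 \<and> v = poly_eval y a / poly_eval y b)"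


section \<open>The spaces of symmetric rational functions and their product\<close>

definition poly_vars :: "mpoly \<Rightarrow> nat set"
  where "poly_vars p = (\<Union>m\<in>Poly_Mapping.keys p. Poly_Mapping.keys m)"

definition ratfuns :: "nat set \<Rightarrow> ratfun set"
  where "ratfuns S = {Fract a b | a b. b \<noteq> 0 \<and> poly_vars a \<subseteq> S \<and> poly_vars b \<subseteq> S}"

definition sym_ratfuns :: "nat \<Rightarrow> ratfun set"
  where "sym_ratfuns \<alpha> =
    {P \<in> ratfuns {1..\<alpha>}. \<forall>\<sigma>. \<sigma> permutes {1..\<alpha>} \<longrightarrow> ratfun_eval (\<lambda>i. xvar (\<sigma> i)) P = P}"

definition Sym :: "nat \<Rightarrow> ratfun \<Rightarrow> ratfun"
  where "Sym n R = (\<Sum>\<sigma> | \<sigma> permutes {1..n}. ratfun_eval (\<lambda>i. xvar (\<sigma> i)) R)"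

text \<open>
  As the spaces \<open>sym_ratfuns \<alpha>\<close> are subsets of one field, the degrees \<open>\<alpha>\<close> and \<open>\<beta>\<close> of the two
  factors are arguments of the product.
\<close>

definition star :: "nat \<Rightarrow> nat \<Rightarrow> ratfun \<Rightarrow> ratfun \<Rightarrow> ratfun"
  where "star \<alpha> \<beta> P P' =
    1 / (of_nat (fact \<alpha>) * of_nat (fact \<beta>)) *
    Sym (\<alpha> + \<beta>)
      (P * ratfun_eval (\<lambda>i. xvar (\<alpha> + i)) P' /
        (\<Prod>i\<in>{1..\<alpha>}. \<Prod>j\<in>{\<alpha> + 1..\<alpha> + \<beta>}.
           (inverse (xvar j) - inverse (xvar i)) * (xvar j - qq * xvar i)))"

definition xpow :: "nat \<Rightarrow> int \<Rightarrow> ratfun"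
  where "xpow \<alpha> n = (\<Prod>i\<in>{1..\<alpha>}. xvar i) powi n"


section \<open>Well-definedness\<close>

subsection \<open>Evaluation\<close>

lemma scal_add: "scal (a + b) = scal a + scal b"
  by (simp add: scal_def single_add)

lemma scal_mult: "scal (a * b) = scal a * scal b"
  by (simp add: scal_def mult_single flip: to_fract_mult)

lemma scal_0 [simp]: "scal 0 = 0"
  by (simp add: scal_def)

lemma scal_1 [simp]: "scal 1 = 1"
  by (simp add: scal_def)

lemma mono_eval_superset:
  assumes "finite A" "Poly_Mapping.keys m \<subseteq> A"
  shows "mono_eval y m = (\<Prod>i\<in>A. y i ^ Poly_Mapping.lookup m i)"
  unfolding mono_eval_def
  by (rule prod.mono_neutral_left) (use assms in \<open>auto simp: in_keys_iff\<close>)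

lemma mono_eval_0 [simp]: "mono_eval y 0 = 1"
  by (simp add: mono_eval_def)

lemma mono_eval_add: "mono_eval y (m + m') = mono_eval y m * mono_eval y m'"
proof -
  let ?A = "Poly_Mapping.keys m \<union> Poly_Mapping.keys m'"
  have "mono_eval y (m + m') = (\<Prod>i\<in>?A. y i ^ Poly_Mapping.lookup (m + m') i)"
    by (rule mono_eval_superset) (use Poly_Mapping.keys_add[of m m'] in auto)
  also have "\<dots> = (\<Prod>i\<in>?A. y i ^ Poly_Mapping.lookup m i) * (\<Prod>i\<in>?A. y i ^ Poly_Mapping.lookup m' i)"
    by (simp add: lookup_add power_add prod.distrib)
  also have "\<dots> = mono_eval y m * mono_eval y m'"
    using mono_eval_superset[of ?A m y] mono_eval_superset[of ?A m' y] by simp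
  finally show ?thesis .
qed

lemma mono_eval_single [simp]: "mono_eval y (Poly_Mapping.single i k) = y i ^ k"
  by (simp add: mono_eval_def)

lemma mono_eval_sum:
  "finite A \<Longrightarrow> mono_eval y (\<Sum>i\<in>A. f i) = (\<Prod>i\<in>A. mono_eval y (f i))"
  by (induction A rule: finite_induct) (auto simp: mono_eval_add)

lemma poly_eval_0 [simp]: "poly_eval y 0 = 0"
  by (simp add: poly_eval_def)

lemma poly_eval_single [simp]:
  "poly_eval y (Poly_Mapping.single m c) = scal c * mono_eval y m"
  by (simp add: poly_eval_def)

lemma poly_eval_1 [simp]: "poly_eval y 1 = 1"
  using poly_eval_single[of y 0 1] by simp

lemma poly_eval_add: "poly_eval y (p + p') = poly_eval y p + poly_eval y p'"
  unfolding poly_eval_def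
  by (rule setsum_keys_plus_distrib) (auto simp: scal_add algebra_simps)

lemma poly_eval_sum:
  "finite A \<Longrightarrow> poly_eval y (\<Sum>i\<in>A. f i) = (\<Sum>i\<in>A. poly_eval y (f i))"
  by (induction A rule: finite_induct) (auto simp: poly_eval_add)

lemma poly_mapping_sum_singles:
  fixes p :: "'a \<Rightarrow>\<^sub>0 'b::comm_monoid_add"
  shows "p = (\<Sum>m\<in>Poly_Mapping.keys p. Poly_Mapping.single m (Poly_Mapping.lookup p m))"
proof (rule poly_mapping_eqI)
  fix k
  have "(\<Sum>m\<in>Poly_Mapping.keys p. Poly_Mapping.lookup p m when m = k) =
      (\<Sum>m\<in>Poly_Mapping.keys p. if m = k then Poly_Mapping.lookup p m else 0)"
    by (simp add: when_def)
  also have "\<dots> = Poly_Mapping.lookup p k"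
    by (simp add: sum.delta in_keys_iff)
  finally show "Poly_Mapping.lookup p k = Poly_Mapping.lookup
      (\<Sum>m\<in>Poly_Mapping.keys p. Poly_Mapping.single m (Poly_Mapping.lookup p m)) k"
    by (simp add: lookup_sum lookup_single)
qed

lemma poly_eval_mult: "poly_eval y (p * p') = poly_eval y p * poly_eval y p'"
proof -
  let ?s = "\<lambda>p m. Poly_Mapping.single m (Poly_Mapping.lookup p m)"
  have "p * p' = (\<Sum>m\<in>Poly_Mapping.keys p. ?s p m) * (\<Sum>m\<in>Poly_Mapping.keys p'. ?s p' m)"
    by (simp flip: poly_mapping_sum_singles)
  also have "\<dots> = (\<Sum>m\<in>Poly_Mapping.keys p. \<Sum>m'\<in>Poly_Mapping.keys p'. ?s p m * ?s p' m')"
    by (simp add: sum_product)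
  finally have "poly_eval y (p * p') =
      (\<Sum>m\<in>Poly_Mapping.keys p. \<Sum>m'\<in>Poly_Mapping.keys p'. poly_eval y (?s p m * ?s p' m'))"
    by (simp add: poly_eval_sum)
  also have "\<dots> = (\<Sum>m\<in>Poly_Mapping.keys p. \<Sum>m'\<in>Poly_Mapping.keys p'.
      poly_eval y (?s p m) * poly_eval y (?s p' m'))"
    by (intro sum.cong refl) (simp add: mult_single scal_mult mono_eval_add)
  also have "\<dots> = poly_eval y p * poly_eval y p'"
    unfolding poly_eval_single by (simp only: sum_product poly_eval_def)
  finally show ?thesis .
qed

lemma ratfun_eval_fract:
  assumes "poly_eval y b \<noteq> 0"
  shows "ratfun_eval y (Fract a b) = poly_eval y a / poly_eval y b"
  unfolding ratfun_eval_def
proof (rule the_equality)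
  fix v
  assume "\<exists>a' b'. Fract a b = Fract a' b' \<and> poly_eval y b' \<noteq> 0 \<and> v = poly_eval y a' / poly_eval y b'"
  then obtain a' b' where *: "Fract a b = Fract a' b'" "poly_eval y b' \<noteq> 0"
    and v: "v = poly_eval y a' / poly_eval y b'" by blast
  have "b \<noteq> 0" "b' \<noteq> 0" using assms *(2) by auto
  then have "a * b' = a' * b" using *(1) by (simp add: eq_fract)
  then have "poly_eval y a * poly_eval y b' = poly_eval y a' * poly_eval y b"
    by (metis poly_eval_mult)
  then show "v = poly_eval y a / poly_eval y b"
    using assms *(2) v by (simp add: frac_eq_eq)
qed (use assms in blast)


subsection \<open>Renaming of variables\<close>

definition mono_rename :: "(nat \<Rightarrow> nat) \<Rightarrow> (nat \<Rightarrow>\<^sub>0 nat) \<Rightarrow> (nat \<Rightarrow>\<^sub>0 nat)"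
  where "mono_rename f m = (\<Sum>i\<in>Poly_Mapping.keys m. Poly_Mapping.single (f i) (Poly_Mapping.lookup m i))"

definition poly_rename :: "(nat \<Rightarrow> nat) \<Rightarrow> mpoly \<Rightarrow> mpoly"
  where "poly_rename f p =
    (\<Sum>m\<in>Poly_Mapping.keys p. Poly_Mapping.single (mono_rename f m) (Poly_Mapping.lookup p m))"

lemma lookup_mono_rename:
  assumes "inj f"
  shows "Poly_Mapping.lookup (mono_rename f m) (f i) = Poly_Mapping.lookup m i"
proof -
  have "Poly_Mapping.lookup (mono_rename f m) (f i) =
      (\<Sum>k\<in>Poly_Mapping.keys m. if k = i then Poly_Mapping.lookup m k else 0)"
    by (simp add: mono_rename_def lookup_sum lookup_single when_def inj_eq[OF assms])
  then show ?thesis by (simp add: sum.delta in_keys_iff)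
qed

lemma inj_mono_rename: "inj f \<Longrightarrow> inj (mono_rename f)"
  by (rule injI) (metis lookup_mono_rename poly_mapping_eqI)

lemma keys_mono_rename: "Poly_Mapping.keys (mono_rename f m) \<subseteq> f ` Poly_Mapping.keys m"
proof -
  have "Poly_Mapping.keys (mono_rename f m) \<subseteq>
      (\<Union>i\<in>Poly_Mapping.keys m. Poly_Mapping.keys (Poly_Mapping.single (f i) (Poly_Mapping.lookup m i)))"
    unfolding mono_rename_def by (rule keys_sum)
  also have "\<dots> \<subseteq> f ` Poly_Mapping.keys m" by auto
  finally show ?thesis .
qed

lemma poly_vars_rename: "poly_vars (poly_rename f p) \<subseteq> f ` poly_vars p"
proof -
  have "Poly_Mapping.keys (poly_rename f p) \<subseteq> mono_rename f ` Poly_Mapping.keys p"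
  proof -
    have "Poly_Mapping.keys (poly_rename f p) \<subseteq> (\<Union>m\<in>Poly_Mapping.keys p.
        Poly_Mapping.keys (Poly_Mapping.single (mono_rename f m) (Poly_Mapping.lookup p m)))"
      unfolding poly_rename_def by (rule keys_sum)
    also have "\<dots> \<subseteq> mono_rename f ` Poly_Mapping.keys p" by auto
    finally show ?thesis .
  qed
  then have "poly_vars (poly_rename f p) \<subseteq>
      (\<Union>m\<in>mono_rename f ` Poly_Mapping.keys p. Poly_Mapping.keys m)"
    unfolding poly_vars_def by (rule UN_mono) simp
  also have "\<dots> \<subseteq> (\<Union>m\<in>Poly_Mapping.keys p. f ` Poly_Mapping.keys m)"
    unfolding image_image by (rule UN_mono[OF subset_refl keys_mono_rename])
  finally show ?thesis
    by (simp only: poly_vars_def image_UN)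
qed

lemma poly_rename_eq_0_iff:
  assumes "inj f"
  shows "poly_rename f p = 0 \<longleftrightarrow> p = 0"
proof
  assume *: "poly_rename f p = 0"
  show "p = 0"
  proof (rule poly_mapping_eqI)
    fix m
    have "Poly_Mapping.lookup (poly_rename f p) (mono_rename f m) =
        (\<Sum>k\<in>Poly_Mapping.keys p. if k = m then Poly_Mapping.lookup p k else 0)"
      by (simp add: poly_rename_def lookup_sum lookup_single when_def inj_eq[OF inj_mono_rename[OF assms]])
    then show "Poly_Mapping.lookup p m = Poly_Mapping.lookup 0 m"
      using * by (simp add: sum.delta in_keys_iff split: if_splits)
  qed
qed (simp add: poly_rename_def)

lemma mono_eval_rename: "mono_eval y (mono_rename f m) = mono_eval (\<lambda>i. y (f i)) m"
  by (simp add: mono_rename_def mono_eval_sum) (simp add: mono_eval_def)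

lemma poly_eval_rename: "poly_eval y (poly_rename f p) = poly_eval (\<lambda>i. y (f i)) p"
  by (simp add: poly_rename_def poly_eval_sum mono_eval_rename) (simp add: poly_eval_def)

lemma xvar_power: "xvar i ^ k = to_fract (Poly_Mapping.single (Poly_Mapping.single i k) 1)"
  by (induction k) (auto simp: xvar_def mult_single simp flip: to_fract_mult single_add)

lemma mono_eval_xvar: "mono_eval xvar m = to_fract (Poly_Mapping.single m 1)"
proof -
  have *: "finite A \<Longrightarrow> (\<Prod>i\<in>A. to_fract (Poly_Mapping.single (g i) (1::qrat))) =
      to_fract (Poly_Mapping.single (\<Sum>i\<in>A. g i) 1)" for A and g :: "nat \<Rightarrow> nat \<Rightarrow>\<^sub>0 nat"
    by (induction A rule: finite_induct) (auto simp: mult_single simp flip: to_fract_mult)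
  show ?thesis
    by (simp add: mono_eval_def xvar_power * flip: poly_mapping_sum_singles)
qed

lemma to_fract_sum: "finite A \<Longrightarrow> to_fract (\<Sum>i\<in>A. f i) = (\<Sum>i\<in>A. to_fract (f i))"
  by (induction A rule: finite_induct) auto

lemma poly_eval_xvar [simp]: "poly_eval xvar p = to_fract p"
proof -
  have "poly_eval xvar p =
      (\<Sum>m\<in>Poly_Mapping.keys p. to_fract (Poly_Mapping.single m (Poly_Mapping.lookup p m)))"
    unfolding poly_eval_def
    by (intro sum.cong refl) (simp add: scal_def mono_eval_xvar mult_single flip: to_fract_mult)
  then show ?thesis
    by (simp flip: to_fract_sum poly_mapping_sum_singles)
qed

lemma poly_eval_xvar_rename: "poly_eval (\<lambda>i. xvar (f i)) p = to_fract (poly_rename f p)"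
  using poly_eval_rename[of xvar f p] by simp

lemma ratfun_eval_rename:
  assumes "inj f" "b \<noteq> 0"
  shows "ratfun_eval (\<lambda>i. xvar (f i)) (Fract a b) = Fract (poly_rename f a) (poly_rename f b)"
  using assms
  by (simp add: ratfun_eval_fract poly_eval_xvar_rename poly_rename_eq_0_iff Fract_conv_to_fract[of "poly_rename f a"])

lemma poly_rename_add: "poly_rename f (p + p') = poly_rename f p + poly_rename f p'"
  by (simp add: poly_eval_add flip: to_fract_eq_iff poly_eval_xvar_rename)

lemma poly_rename_mult: "poly_rename f (p * p') = poly_rename f p * poly_rename f p'"
  by (simp add: poly_eval_mult flip: to_fract_eq_iff poly_eval_xvar_rename)

lemma poly_rename_comp: "poly_rename g (poly_rename f p) = poly_rename (\<lambda>i. g (f i)) p"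
  by (simp add: poly_eval_rename flip: to_fract_eq_iff poly_eval_xvar_rename)

lemma rename_comp:
  assumes "inj f" "inj g"
  shows "ratfun_eval (\<lambda>i. xvar (g i)) (ratfun_eval (\<lambda>i. xvar (f i)) r) =
    ratfun_eval (\<lambda>i. xvar (g (f i))) r"
proof (cases r rule: Fract_cases)
  case (Fract a b)
  moreover have "inj (\<lambda>i. g (f i))" using inj_compose[OF assms(2,1)] by (simp add: o_def)
  ultimately show ?thesis
    using assms by (simp add: ratfun_eval_rename poly_rename_eq_0_iff poly_rename_comp)
qed

lemma rename_add:
  assumes "inj f"
  shows "ratfun_eval (\<lambda>i. xvar (f i)) (r + s) =
    ratfun_eval (\<lambda>i. xvar (f i)) r + ratfun_eval (\<lambda>i. xvar (f i)) s"
proof (cases r rule: Fract_cases)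
  case r: (Fract a b)
  show ?thesis
  proof (cases s rule: Fract_cases)
    case (Fract c d)
    then show ?thesis using r assms
      by (simp add: ratfun_eval_rename poly_rename_eq_0_iff poly_rename_add poly_rename_mult)
  qed
qed

lemma rename_mult:
  assumes "inj f"
  shows "ratfun_eval (\<lambda>i. xvar (f i)) (r * s) =
    ratfun_eval (\<lambda>i. xvar (f i)) r * ratfun_eval (\<lambda>i. xvar (f i)) s"
proof (cases r rule: Fract_cases)
  case r: (Fract a b)
  show ?thesis
  proof (cases s rule: Fract_cases)
    case (Fract c d)
    then show ?thesis using r assms
      by (simp add: ratfun_eval_rename poly_rename_eq_0_iff poly_rename_mult)
  qed
qed

lemma rename_scal: "ratfun_eval y (scal c) = scal c"
  using ratfun_eval_fract[of y 1 "Poly_Mapping.single 0 c"]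
  by (simp add: scal_def to_fract_def)

lemma rename_xvar: "ratfun_eval y (xvar i) = y i"
  using ratfun_eval_fract[of y 1 "Poly_Mapping.single (Poly_Mapping.single i 1) 1"]
  by (simp add: xvar_def to_fract_def)

lemma rename_0: "ratfun_eval y 0 = 0"
  using rename_scal[of y 0] by simp

lemma rename_1: "ratfun_eval y 1 = 1"
  using rename_scal[of y 1] by simp

lemma rename_inverse:
  assumes "inj f"
  shows "ratfun_eval (\<lambda>i. xvar (f i)) (inverse r) = inverse (ratfun_eval (\<lambda>i. xvar (f i)) r)"
proof (cases "r = 0")
  case False
  have "ratfun_eval (\<lambda>i. xvar (f i)) r * ratfun_eval (\<lambda>i. xvar (f i)) (inverse r) = 1"
    using False by (simp add: rename_1 flip: rename_mult[OF assms])
  then show ?thesis by (metis inverse_unique)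
qed (simp add: rename_0)

lemma rename_sum:
  assumes "inj f"
  shows "ratfun_eval (\<lambda>i. xvar (f i)) (\<Sum>k\<in>A. g k) = (\<Sum>k\<in>A. ratfun_eval (\<lambda>i. xvar (f i)) (g k))"
  by (induction A rule: infinite_finite_induct) (auto simp: rename_0 rename_add[OF assms])

lemma rename_prod:
  assumes "inj f"
  shows "ratfun_eval (\<lambda>i. xvar (f i)) (\<Prod>k\<in>A. g k) = (\<Prod>k\<in>A. ratfun_eval (\<lambda>i. xvar (f i)) (g k))"
  by (induction A rule: infinite_finite_induct) (auto simp: rename_1 rename_mult[OF assms])

lemma rename_power:
  assumes "inj f"
  shows "ratfun_eval (\<lambda>i. xvar (f i)) (r ^ k) = ratfun_eval (\<lambda>i. xvar (f i)) r ^ k"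
  by (induction k) (auto simp: rename_1 rename_mult[OF assms])

lemma rename_powi:
  assumes "inj f"
  shows "ratfun_eval (\<lambda>i. xvar (f i)) (r powi k) = ratfun_eval (\<lambda>i. xvar (f i)) r powi k"
  by (simp add: power_int_def rename_power[OF assms] rename_inverse[OF assms])


subsection \<open>Closure\<close>

lemma poly_vars_add: "poly_vars (p + p') \<subseteq> poly_vars p \<union> poly_vars p'"
  unfolding poly_vars_def using Poly_Mapping.keys_add[of p p'] by blast

lemma poly_vars_mult: "poly_vars (p * p') \<subseteq> poly_vars p \<union> poly_vars p'"
proof
  fix i assume "i \<in> poly_vars (p * p')"
  then obtain m where m: "m \<in> Poly_Mapping.keys (p * p')" "i \<in> Poly_Mapping.keys m"
    by (auto simp: poly_vars_def)
  then obtain a b where "m = a + b" "a \<in> Poly_Mapping.keys p" "b \<in> Poly_Mapping.keys p'"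
    using keys_mult[of p p'] by blast
  moreover from this have "i \<in> Poly_Mapping.keys a \<union> Poly_Mapping.keys b"
    using m(2) Poly_Mapping.keys_add[of a b] by blast
  ultimately show "i \<in> poly_vars p \<union> poly_vars p'" by (auto simp: poly_vars_def)
qed

lemma ratfunsI: "b \<noteq> 0 \<Longrightarrow> poly_vars a \<subseteq> S \<Longrightarrow> poly_vars b \<subseteq> S \<Longrightarrow> Fract a b \<in> ratfuns S"
  by (auto simp: ratfuns_def)

lemma ratfuns_scal: "scal c \<in> ratfuns S"
  unfolding scal_def to_fract_def by (rule ratfunsI) (auto simp: poly_vars_def)

lemma ratfuns_xvar: "i \<in> S \<Longrightarrow> xvar i \<in> ratfuns S"
  unfolding xvar_def to_fract_def by (rule ratfunsI) (auto simp: poly_vars_def)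

lemma ratfuns_add: "r \<in> ratfuns S \<Longrightarrow> s \<in> ratfuns S \<Longrightarrow> r + s \<in> ratfuns S"
proof -
  assume "r \<in> ratfuns S" "s \<in> ratfuns S"
  then obtain a b c d where "r = Fract a b" "b \<noteq> 0" "poly_vars a \<subseteq> S" "poly_vars b \<subseteq> S"
    "s = Fract c d" "d \<noteq> 0" "poly_vars c \<subseteq> S" "poly_vars d \<subseteq> S"
    by (auto simp: ratfuns_def)
  then show ?thesis
    using poly_vars_mult[of a d] poly_vars_mult[of c b] poly_vars_mult[of b d]
      poly_vars_add[of "a * d" "c * b"]
    by (simp, intro ratfunsI) (simp, blast+)
qed

lemma ratfuns_mult: "r \<in> ratfuns S \<Longrightarrow> s \<in> ratfuns S \<Longrightarrow> r * s \<in> ratfuns S"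
proof -
  assume "r \<in> ratfuns S" "s \<in> ratfuns S"
  then obtain a b c d where "r = Fract a b" "b \<noteq> 0" "poly_vars a \<subseteq> S" "poly_vars b \<subseteq> S"
    "s = Fract c d" "d \<noteq> 0" "poly_vars c \<subseteq> S" "poly_vars d \<subseteq> S"
    by (auto simp: ratfuns_def)
  then show ?thesis
    using poly_vars_mult[of a c] poly_vars_mult[of b d]
    by (simp, intro ratfunsI) (simp, blast+)
qed

lemma ratfuns_inverse:
  assumes "r \<in> ratfuns S"
  shows "inverse r \<in> ratfuns S"
proof (cases "r = 0")
  case True
  then show ?thesis using assms by simp
next
  case False
  obtain a b where "r = Fract a b" "b \<noteq> 0" "poly_vars a \<subseteq> S" "poly_vars b \<subseteq> S"
    using assms by (auto simp: ratfuns_def)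
  then show ?thesis using False by (auto intro!: ratfunsI simp: fract_collapse)
qed

lemma ratfuns_0: "0 \<in> ratfuns S" and ratfuns_1: "1 \<in> ratfuns S"
  using ratfuns_scal[of 0] ratfuns_scal[of 1] by auto

lemma ratfuns_diff:
  assumes "r \<in> ratfuns S" "s \<in> ratfuns S"
  shows "r - s \<in> ratfuns S"
proof -
  have "scal (-1) + scal 1 = 0" unfolding scal_add [symmetric] by simp
  then have "scal (-1) = -1" by (simp add: eq_neg_iff_add_eq_0)
  then have "r - s = r + scal (-1) * s" by simp
  then show ?thesis using assms by (simp only: ratfuns_add ratfuns_mult ratfuns_scal)
qed

lemma ratfuns_divide: "r \<in> ratfuns S \<Longrightarrow> s \<in> ratfuns S \<Longrightarrow> r / s \<in> ratfuns S"
  by (simp add: divide_inverse ratfuns_mult ratfuns_inverse)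

lemma ratfuns_sum: "(\<And>k. k \<in> A \<Longrightarrow> g k \<in> ratfuns S) \<Longrightarrow> (\<Sum>k\<in>A. g k) \<in> ratfuns S"
  by (induction A rule: infinite_finite_induct) (auto simp: ratfuns_0 ratfuns_add)

lemma ratfuns_prod: "(\<And>k. k \<in> A \<Longrightarrow> g k \<in> ratfuns S) \<Longrightarrow> (\<Prod>k\<in>A. g k) \<in> ratfuns S"
  by (induction A rule: infinite_finite_induct) (auto simp: ratfuns_1 ratfuns_mult)

lemma ratfuns_power: "r \<in> ratfuns S \<Longrightarrow> r ^ k \<in> ratfuns S"
  by (induction k) (auto simp: ratfuns_1 ratfuns_mult)

lemma ratfuns_powi: "r \<in> ratfuns S \<Longrightarrow> r powi k \<in> ratfuns S"
  by (simp add: power_int_def ratfuns_power ratfuns_inverse)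

lemma ratfuns_of_nat: "of_nat k \<in> ratfuns S"
  by (induction k) (auto simp: ratfuns_0 ratfuns_1 ratfuns_add)

lemma ratfuns_mono: "S \<subseteq> T \<Longrightarrow> ratfuns S \<subseteq> ratfuns T"
  unfolding ratfuns_def by blast

lemma ratfuns_rename:
  assumes "inj f" "f ` S \<subseteq> T" "r \<in> ratfuns S"
  shows "ratfun_eval (\<lambda>i. xvar (f i)) r \<in> ratfuns T"
proof -
  obtain a b where "r = Fract a b" "b \<noteq> 0" "poly_vars a \<subseteq> S" "poly_vars b \<subseteq> S"
    using assms(3) by (auto simp: ratfuns_def)
  then show ?thesis
    using assms(1,2) poly_vars_rename[of f a] poly_vars_rename[of f b]
    by (simp add: ratfun_eval_rename, intro ratfunsI) (simp add: poly_rename_eq_0_iff, blast+)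
qed

lemma xpow_sym: "xpow \<alpha> n \<in> sym_ratfuns \<alpha>"
  unfolding sym_ratfuns_def
proof (intro CollectI conjI allI impI)
  show "xpow \<alpha> n \<in> ratfuns {1..\<alpha>}"
    unfolding xpow_def by (intro ratfuns_powi ratfuns_prod ratfuns_xvar)
  fix \<sigma> assume \<sigma>: "\<sigma> permutes {1..\<alpha>}"
  note inj = permutes_inj[OF \<sigma>]
  show "ratfun_eval (\<lambda>i. xvar (\<sigma> i)) (xpow \<alpha> n) = xpow \<alpha> n"
    unfolding xpow_def rename_powi[OF inj] rename_prod[OF inj] rename_xvar
    using prod.permute[OF \<sigma>, of xvar] by (simp only: o_def)
qed

lemma rename_of_nat:
  assumes "inj f"
  shows "ratfun_eval (\<lambda>i. xvar (f i)) (of_nat k) = of_nat k"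
  by (induction k) (auto simp: rename_0 rename_1 rename_add[OF assms])

theorem star_closed:
  assumes P: "P \<in> sym_ratfuns \<alpha>" and P': "P' \<in> sym_ratfuns \<beta>"
  shows "star \<alpha> \<beta> P P' \<in> sym_ratfuns (\<alpha> + \<beta>)"
proof -
  define R where "R = P * ratfun_eval (\<lambda>i. xvar (\<alpha> + i)) P' /
        (\<Prod>i\<in>{1..\<alpha>}. \<Prod>j\<in>{\<alpha> + 1..\<alpha> + \<beta>}.
           (inverse (xvar j) - inverse (xvar i)) * (xvar j - qq * xvar i))"
  define c :: ratfun where "c = 1 / (of_nat (fact \<alpha>) * of_nat (fact \<beta>))"
  have star: "star \<alpha> \<beta> P P' = c * Sym (\<alpha> + \<beta>) R"
    by (simp add: star_def R_def c_def)
  have "P \<in> ratfuns {1..\<alpha> + \<beta>}"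
    using P ratfuns_mono[of "{1..\<alpha>}" "{1..\<alpha> + \<beta>}"] by (auto simp: sym_ratfuns_def)
  moreover have "ratfun_eval (\<lambda>i. xvar (\<alpha> + i)) P' \<in> ratfuns {1..\<alpha> + \<beta>}"
    by (rule ratfuns_rename[where S = "{1..\<beta>}"]) (use P' in \<open>auto simp: sym_ratfuns_def\<close>)
  ultimately have R: "R \<in> ratfuns {1..\<alpha> + \<beta>}"
    unfolding R_def qq_def
    by (intro ratfuns_divide ratfuns_mult ratfuns_prod ratfuns_diff ratfuns_inverse
        ratfuns_xvar ratfuns_scal) auto
  have c: "c \<in> ratfuns S" for S
    unfolding c_def by (intro ratfuns_divide ratfuns_mult ratfuns_1 ratfuns_of_nat)
  have "star \<alpha> \<beta> P P' \<in> ratfuns {1..\<alpha> + \<beta>}"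
    unfolding star Sym_def
    by (intro ratfuns_mult c ratfuns_sum ratfuns_rename[OF _ _ R])
      (auto simp: permutes_inj permutes_image)
  moreover have "ratfun_eval (\<lambda>i. xvar (\<sigma> i)) (star \<alpha> \<beta> P P') = star \<alpha> \<beta> P P'"
    if \<sigma>: "\<sigma> permutes {1..\<alpha> + \<beta>}" for \<sigma>
  proof -
    note inj = permutes_inj[OF \<sigma>]
    have "ratfun_eval (\<lambda>i. xvar (\<sigma> i)) c = c"
      unfolding c_def
      by (simp add: divide_inverse rename_inverse[OF inj] rename_mult[OF inj] rename_of_nat[OF inj] del: inverse_mult_distrib)
    moreover have "ratfun_eval (\<lambda>i. xvar (\<sigma> i)) (Sym (\<alpha> + \<beta>) R) = Sym (\<alpha> + \<beta>) R"
    proof -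
      have "ratfun_eval (\<lambda>i. xvar (\<sigma> i)) (Sym (\<alpha> + \<beta>) R) =
          (\<Sum>\<tau> | \<tau> permutes {1..\<alpha> + \<beta>}. ratfun_eval (\<lambda>i. xvar ((\<sigma> \<circ> \<tau>) i)) R)"
        unfolding Sym_def rename_sum[OF inj]
        by (intro sum.cong refl) (auto simp: rename_comp inj permutes_inj)
      also have "\<dots> = Sym (\<alpha> + \<beta>) R"
        unfolding Sym_def
        by (rule setum_permutations_compose_left[OF \<sigma>, symmetric])
      finally show ?thesis .
    qed
    ultimately show ?thesis by (simp add: star rename_mult[OF inj])
  qed
  ultimately show ?thesis by (simp add: sym_ratfuns_def)
qed

end

theory Submission
  imports Defs
begin

text \<open>
  Summing over permutations amounts to summing over the set \<open>I\<close> of the variables that go to the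
  first factor, so each of the products is, up to a power of \<open>x\<^sub>1 x\<^sub>2 \<dots>\<close>, a sum of the terms
  \<open>\<Prod>\<^sub>I x\<^sub>i\<^sup>a \<Prod>\<^sub>J x\<^sub>j\<^sup>b / \<Prod>\<^sub>I\<^sub>,\<^sub>J (x\<^sub>i - x\<^sub>j)(x\<^sub>j - q x\<^sub>i)\<close> over all \<open>I\<close> of a given size, with \<open>J\<close> the
  complement of \<open>I\<close>.  As a function of one variable \<open>z\<close> this sum vanishes at infinity in the
  relevant range of exponents; it has simple poles, and those at \<open>z = x\<^sub>r\<close> cancel between \<open>I\<close> and the
  set obtained by exchanging \<open>z\<close> and \<open>x\<^sub>r\<close>.  The residue at \<open>z = q x\<^sub>r\<close> or \<open>z = x\<^sub>r / q\<close> is a factor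
  depending only on \<open>a + b\<close>, times a power of \<open>q\<close>, times the same sum with \<open>z\<close> and \<open>x\<^sub>r\<close> removed.
  Hence both relations follow by induction on the number of variables; only a pole at \<open>z = 0\<close>, which
  occurs if an exponent is \<open>-1\<close>, needs a separate comparison.
\<close>

section \<open>Partial fractions\<close>

text \<open>Peeling off one node c leaves the elementary partial fractions of
  \<open>z ^ s / ((z - a) * (z - c))\<close> with s at most 1, since one power of z can be spent on
  the new node. The contributions at c then add up to the identity for the remaining nodes, taken at
  the point c.\<close>

lemma lagrange_partial_fractions:
  fixes z :: "'a::field"
  assumes "finite A" "m < card A" "z \<notin> A"
  shows "z ^ m / (\<Prod>a\<in>A. z - a) =
    (\<Sum>a\<in>A. a ^ m / (\<Prod>b\<in>A - {a}. a - b) / (z - a))"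
  using assms
proof (induction A arbitrary: m z rule: finite_induct)
  case (insert c A)
  let ?P = "\<lambda>a. \<Prod>b\<in>A - {a}. a - b"
  have zc: "z - c \<noteq> 0" and za: "\<And>a. a \<in> A \<Longrightarrow> z - a \<noteq> 0"
    using insert.prems by auto
  have ac: "a - c \<noteq> 0" if "a \<in> A" for a using that insert.hyps by auto
  have split: "(\<Sum>a\<in>insert c A. a ^ m / (\<Prod>b\<in>insert c A - {a}. a - b) / (z - a)) =
      c ^ m / (\<Prod>b\<in>A. c - b) / (z - c) + (\<Sum>a\<in>A. a ^ m / ((a - c) * ?P a) / (z - a))"
  proof -
    have "(\<Prod>b\<in>insert c A - {a}. a - b) = (a - c) * ?P a" if "a \<in> A" for a
    proof -
      have "insert c A - {a} = insert c (A - {a})" using that insert.hyps by auto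
      then show ?thesis using insert.hyps by simp
    qed
    then show ?thesis using insert.hyps by simp
  qed
  show ?case
  proof (cases "A = {}")
    case True
    then show ?thesis using insert.prems by simp
  next
    case False
    then have cardA: "card A > 0" using insert.hyps by (simp add: card_gt_0_iff)
    \<comment> \<open>Truncated subtraction: for \<open>m = 0\<close> also \<open>m' = 0\<close>,
      which is still below \<open>card A\<close> because \<open>A\<close> is nonempty. Hence the
      leftover exponent \<open>s\<close> is 0 or 1.\<close>
    define m' where "m' = m - 1"
    have m': "m' < card A" using insert.prems insert.hyps cardA by (auto simp: m'_def)
    obtain s where s: "s = (0::nat) \<or> s = 1" and m: "m = m' + s"
      using m'_def by (cases m) (auto intro: that[of 0] that[of 1])
    note IH = insert.IH[OF m']
    have frac: "w ^ s * (1 / (z - a) / (z - c)) = a ^ s / (a - c) / (z - a) + - (c ^ s / (a - c) / (z - c))"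
      if "a \<in> A" "w = z" for a w
      using s ac[OF that(1)] za[OF that(1)] zc that(2)
      by (elim disjE; simp add: divide_simps) (simp_all add: algebra_simps)
    have "z ^ m / (\<Prod>a\<in>insert c A. z - a) = z ^ s * (z ^ m' / (\<Prod>a\<in>A. z - a)) / (z - c)"
      using insert.hyps by (simp add: m power_add mult_ac)
    also have "\<dots> = (\<Sum>a\<in>A. a ^ m' / ?P a * (z ^ s * (1 / (z - a) / (z - c))))"
      using insert.prems by (simp add: IH sum_distrib_left sum_divide_distrib mult_ac)
    also have "\<dots> = (\<Sum>a\<in>A. a ^ m' / ?P a * (a ^ s / (a - c) / (z - a)) + c ^ s / (z - c) * (a ^ m' / ?P a / (c - a)))"
    proof (rule sum.cong[OF refl])
      fix a assume a: "a \<in> A"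
      have "- (1 / (a - c)) = 1 / (c - a)" using ac[OF a] by (simp add: minus_divide_right)
      then have "- (c ^ s / (a - c) / (z - c)) = c ^ s / (z - c) * (1 / (c - a))"
        by (metis (no_types, lifting) divide_divide_eq_left' minus_divide_left mult.commute mult_minus_right times_divide_eq_right mult.right_neutral)
      then show "a ^ m' / ?P a * (z ^ s * (1 / (z - a) / (z - c))) = a ^ m' / ?P a * (a ^ s / (a - c) / (z - a)) + c ^ s / (z - c) * (a ^ m' / ?P a / (c - a))"
        unfolding frac[OF a refl] by (simp add: distrib_left mult_ac)
    qed
    \<comment> \<open>The induction hypothesis is used a second time, from right to left and at the
      point \<open>c\<close> in place of \<open>z\<close>.\<close>
    also have "\<dots> = (\<Sum>a\<in>A. a ^ m / ((a - c) * ?P a) / (z - a)) + c ^ s / (z - c) * (c ^ m' / (\<Prod>a\<in>A. c - a))"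
      unfolding sum.distrib sum_distrib_left[symmetric] IH[OF insert.hyps(2), symmetric]
      by (simp add: m power_add mult_ac)
    also have "\<dots> = (\<Sum>a\<in>insert c A. a ^ m / (\<Prod>b\<in>insert c A - {a}. a - b) / (z - a))"
      unfolding split by (simp add: m power_add mult_ac)
    finally show ?thesis .
  qed
qed simp

section \<open>The kernel of the product as a function of one variable\<close>

text \<open>The inverse of a denominator factor of \<open>star\<close> is u v times this kernel.
  With u v moved into the exponents, what remains has a denominator of degree 2 in each variable,
  whence the bounds by twice a cardinality below.\<close>

definition kern :: "'a::field \<Rightarrow> 'a \<Rightarrow> 'a \<Rightarrow> 'a"
  where "kern q u v = inverse ((u - v) * (v - q * u))"

text \<open>Produces monic linear factors in \<open>w\<close>, with zeros j and j / q, as Lagrange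
  interpolation requires.\<close>

lemma prod_kern:
  assumes "q \<noteq> 0" "finite X"
  shows "(\<Prod>j\<in>X. kern q w j) =
    (- inverse q) ^ card X / ((\<Prod>j\<in>X. w - j) * (\<Prod>j\<in>X. w - j / q))"
proof -
  have "kern q w j = (- inverse q) / ((w - j) * (w - j / q))" for j
  proof -
    have "j - q * w = (- q) * (w - j / q)" using assms by (simp add: field_simps)
    then show ?thesis using assms
      by (simp add: kern_def divide_inverse mult_ac)
  qed
  then have "(\<Prod>j\<in>X. kern q w j) = (\<Prod>j\<in>X. (- inverse q) / ((w - j) * (w - j / q)))" by simp
  also have "\<dots> = (- inverse q) ^ card X / ((\<Prod>j\<in>X. w - j) * (\<Prod>j\<in>X. w - j / q))"
    by (simp only: prod_dividef prod.distrib prod_constant)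
  finally show ?thesis .
qed

text \<open>Lagrange interpolation of \<open>z powi (a + 1)\<close> at the nodes 0, r and r / q for
  r in \<open>J\<close>. The node 0 absorbs the denominator of \<open>z powi (a + 1) / z\<close>,
  which lets \<open>a\<close> start at -1; \<open>neq\<close> keeps \<open>J\<close> apart from the
  nodes r / q, and the upper bound on \<open>a\<close> is the degree condition for
  \<open>2 * card J + 1\<close> nodes.\<close>

lemma kern_partial_fractions_left:
  fixes z q :: "'a::field"
  assumes fin: "finite J" and q: "q \<noteq> 0" and J0: "0 \<notin> J"
    and neq: "\<forall>i\<in>J. \<forall>j\<in>J. i \<noteq> q * j"
    and z: "z \<noteq> 0" "z \<notin> J" "q * z \<notin> J"
    and a: "- 1 \<le> a" "a < 2 * int (card J)"
  shows "z powi a * (\<Prod>j\<in>J. kern q z j) =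
    (\<Sum>r\<in>J. r powi a / (r - q * r) * (\<Prod>j\<in>J - {r}. kern q r j) / (z - r)
        - (r / q) powi a / (r - q * r) * (\<Prod>j\<in>J - {r}. kern q (r / q) j) / (z - r / q))
    + (if a = - 1 then \<Prod>j\<in>J. kern q 0 j else 0) / z"
proof -
  define m where "m = nat (a + 1)"
  define c where "c = - inverse q"
  define N where "N = card J"
  have am: "a = int m - 1" using a by (simp add: m_def)
  have powa: "x powi a = x ^ m / x" if "x \<noteq> 0" for x :: 'a
    using that by (simp add: am power_int_diff)
  define K where "K = (\<lambda>r. r / q) ` J"
  have inj: "inj_on (\<lambda>r. r / q) X" for X using q by (auto intro!: inj_onI)
  have JK: "J \<inter> K = {}"
  proof (rule ccontr)
    assume "J \<inter> K \<noteq> {}"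
    then obtain i j where "i \<in> J" "j \<in> J" "i = j / q" by (auto simp: K_def)
    then have "j = q * i" using q by simp
    with neq \<open>i \<in> J\<close> \<open>j \<in> J\<close> show False by blast
  qed
  have K0: "0 \<notin> K" using J0 q by (auto simp: K_def)
  have zK: "z \<notin> K" using z(3) q by (auto simp: K_def)
  have finK: "finite K" using fin by (simp add: K_def)
  have prodK: "(\<Prod>b\<in>(\<lambda>r. r / q) ` X. f b) = (\<Prod>j\<in>X. f (j / q))" for f :: "'a \<Rightarrow> 'a" and X
    by (simp add: prod.reindex[OF inj])
  have cardA: "card (insert 0 (J \<union> K)) = 2 * N + 1"
    using J0 K0 fin finK JK card_image[OF inj, of J]
    by (simp add: card_Un_disjoint N_def flip: K_def)
  have mA: "m < card (insert 0 (J \<union> K))"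
    unfolding cardA using a by (simp add: m_def N_def)
  have prodA: "(\<Prod>b\<in>insert 0 (J \<union> K). w - b) = w * ((\<Prod>j\<in>J. w - j) * (\<Prod>j\<in>J. w - j / q))" for w
    using J0 K0 fin finK JK by (simp add: prod.union_disjoint) (simp add: K_def prodK)
  have kern: "(\<Prod>j\<in>X. kern q w j) = c ^ card X / ((\<Prod>j\<in>X. w - j) * (\<Prod>j\<in>X. w - j / q))"
    if "finite X" for X w
    using prod_kern[OF q that] by (simp add: c_def)
  have lhs: "z powi a * (\<Prod>j\<in>J. kern q z j) = c ^ N * (z ^ m / (\<Prod>b\<in>insert 0 (J \<union> K). z - b))"
    by (simp only: prodA kern[OF fin] powa[OF z(1)] N_def) simp
  have t0: "c ^ N * (0 ^ m / (\<Prod>b\<in>insert 0 (J \<union> K) - {0}. 0 - b) / (z - 0)) =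
      (if a = - 1 then \<Prod>j\<in>J. kern q 0 j else 0) / z"
  proof -
    have "insert 0 (J \<union> K) - {0} = J \<union> K" using J0 K0 by auto
    then have "(\<Prod>b\<in>insert 0 (J \<union> K) - {0}. 0 - b) = (\<Prod>j\<in>J. 0 - j) * (\<Prod>j\<in>J. 0 - j / q)"
      using fin finK JK by (simp only: prod.union_disjoint) (simp add: K_def prodK)
    \<comment> \<open>Since \<open>0 ^ 0 = 1\<close>, the node 0 contributes for
      \<open>a = - 1\<close> and for no other exponent.\<close>
    moreover have "(0::'a) ^ m = (if a = - 1 then 1 else 0)" by (simp add: am)
    ultimately show ?thesis
      by (simp only: kern[OF fin] N_def) simp
  qed
  have rq: "r - q * r \<noteq> 0" "r \<noteq> 0" if "r \<in> J" for r
    using neq J0 that by auto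
  \<comment> \<open>One factor \<open>c\<close> joins the node difference between r and r / q and
    gives \<open>1 / (r - q * r)\<close> up to sign; the remaining ones make up the kernels over
    \<open>J - {r}\<close>.\<close>
  have cN: "c ^ N = c * c ^ card (J - {r})" if "r \<in> J" for r
    by (simp only: N_def card.remove[OF fin that] power_Suc)
  have t1: "c ^ N * (r ^ m / (\<Prod>b\<in>insert 0 (J \<union> K) - {r}. r - b) / (z - r)) =
      r powi a / (r - q * r) * (\<Prod>j\<in>J - {r}. kern q r j) / (z - r)" if r: "r \<in> J" for r
  proof -
    have "insert 0 (J \<union> K) - {r} = insert 0 ((J - {r}) \<union> K)" using J0 K0 r JK by auto
    moreover have "0 \<notin> (J - {r}) \<union> K" "(J - {r}) \<inter> K = {}" using J0 K0 JK by auto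
    ultimately have "(\<Prod>b\<in>insert 0 (J \<union> K) - {r}. r - b) =
        r * ((\<Prod>j\<in>J - {r}. r - j) * (\<Prod>j\<in>J. r - j / q))"
      using fin finK by (simp add: prod.union_disjoint) (simp add: K_def prodK)
    also have "(\<Prod>j\<in>J. r - j / q) = (r - r / q) * (\<Prod>j\<in>J - {r}. r - j / q)"
      by (rule prod.remove[OF fin r])
    finally have P: "(\<Prod>b\<in>insert 0 (J \<union> K) - {r}. r - b) = (r - r / q) * (r *
        ((\<Prod>j\<in>J - {r}. r - j) * (\<Prod>j\<in>J - {r}. r - j / q)))" by (simp add: mult_ac)
    have C: "c / (r - r / q) = 1 / (r - q * r)"
      using rq[OF r] q by (auto simp: c_def divide_simps algebra_simps)
    have F: "finite (J - {r})" using fin by simp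
    have "c ^ N * (r ^ m / (\<Prod>b\<in>insert 0 (J \<union> K) - {r}. r - b) / (z - r)) =
       c / (r - r / q) * (r ^ m / r) * (c ^ card (J - {r}) / ((\<Prod>j\<in>J - {r}. r - j) * (\<Prod>j\<in>J - {r}. r - j / q))) / (z - r)"
      unfolding P cN[OF r] by (simp add: mult_ac)
    then show ?thesis
      unfolding C kern[OF F] powa[OF rq(2)[OF r]] by (simp add: mult_ac)
  qed
  have t2: "c ^ N * ((r / q) ^ m / (\<Prod>b\<in>insert 0 (J \<union> K) - {r / q}. r / q - b) / (z - r / q)) =
      - ((r / q) powi a / (r - q * r) * (\<Prod>j\<in>J - {r}. kern q (r / q) j) / (z - r / q))" if r: "r \<in> J" for r
  proof -
    let ?K = "(\<lambda>r. r / q) ` (J - {r})"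
    have "r / q \<in> K" unfolding K_def using r by (rule imageI)
    moreover have K': "K - {r / q} = ?K" using q by (auto simp: K_def)
    ultimately have "insert 0 (J \<union> K) - {r / q} = insert 0 (J \<union> ?K)" 
      using J0 K0 JK unfolding K'[symmetric] by auto
    moreover have "0 \<notin> J \<union> ?K" "J \<inter> ?K = {}" using J0 K0 JK K' by auto
    ultimately have "(\<Prod>b\<in>insert 0 (J \<union> K) - {r / q}. r / q - b) =
        r / q * ((\<Prod>j\<in>J. r / q - j) * (\<Prod>j\<in>J - {r}. r / q - j / q))"
      using fin by (simp add: prod.union_disjoint prodK del: times_divide_eq_left)
    also have "(\<Prod>j\<in>J. r / q - j) = (r / q - r) * (\<Prod>j\<in>J - {r}. r / q - j)"
      by (rule prod.remove[OF fin r])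
    finally have P: "(\<Prod>b\<in>insert 0 (J \<union> K) - {r / q}. r / q - b) = (r / q - r) * (r / q *
        ((\<Prod>j\<in>J - {r}. r / q - j) * (\<Prod>j\<in>J - {r}. r / q - j / q)))" by (simp add: mult_ac)
    have C: "c / (r / q - r) = - (1 / (r - q * r))"
      using rq[OF r] q by (auto simp: c_def divide_simps algebra_simps)
    have F: "finite (J - {r})" using fin by simp
    have r0: "r / q \<noteq> 0" using rq[OF r] q by simp
    have "c ^ N * ((r / q) ^ m / (\<Prod>b\<in>insert 0 (J \<union> K) - {r / q}. r / q - b) / (z - r / q)) =
       c / (r / q - r) * ((r / q) ^ m / (r / q)) * (c ^ card (J - {r}) / ((\<Prod>j\<in>J - {r}. r / q - j) * (\<Prod>j\<in>J - {r}. r / q - j / q))) / (z - r / q)"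
      unfolding P cN[OF r] by (simp add: mult_ac)
    then show ?thesis
      unfolding C kern[OF F] powa[OF r0] by (simp add: mult_ac)
  qed
  have "z powi a * (\<Prod>j\<in>J. kern q z j) =
     (\<Sum>x\<in>insert 0 (J \<union> K). c ^ N * (x ^ m / (\<Prod>b\<in>insert 0 (J \<union> K) - {x}. x - b) / (z - x)))"
    unfolding lhs
    by (subst lagrange_partial_fractions[OF _ mA])
      (use fin finK z zK in \<open>auto simp: sum_distrib_left\<close>)
  also have "\<dots> = (if a = - 1 then \<Prod>j\<in>J. kern q 0 j else 0) / z +
      ((\<Sum>x\<in>J. c ^ N * (x ^ m / (\<Prod>b\<in>insert 0 (J \<union> K) - {x}. x - b) / (z - x))) +
       (\<Sum>x\<in>K. c ^ N * (x ^ m / (\<Prod>b\<in>insert 0 (J \<union> K) - {x}. x - b) / (z - x))))"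
    using J0 K0 fin finK JK t0 by (subst sum.insert) (auto simp: sum.union_disjoint)
  also have "(\<Sum>x\<in>K. c ^ N * (x ^ m / (\<Prod>b\<in>insert 0 (J \<union> K) - {x}. x - b) / (z - x))) =
     (\<Sum>r\<in>J. c ^ N * ((r / q) ^ m / (\<Prod>b\<in>insert 0 (J \<union> K) - {r / q}. r / q - b) / (z - r / q)))"
    by (subst (1) K_def) (simp add: sum.reindex[OF inj])
  finally have *: "z powi a * (\<Prod>j\<in>J. kern q z j) = (if a = - 1 then \<Prod>j\<in>J. kern q 0 j else 0) / z +
      ((\<Sum>x\<in>J. c ^ N * (x ^ m / (\<Prod>b\<in>insert 0 (J \<union> K) - {x}. x - b) / (z - x))) +
       (\<Sum>r\<in>J. c ^ N * ((r / q) ^ m / (\<Prod>b\<in>insert 0 (J \<union> K) - {r / q}. r / q - b) / (z - r / q))))" .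
  show ?thesis
    unfolding * sum.distrib[symmetric]
    by (subst add.commute, intro arg_cong2[where f = "(+)"] sum.cong refl)
      (simp only: t1 t2 add_uminus_conv_diff)
qed

lemma kern_inverse:
  assumes "q \<noteq> 0"
  shows "kern q u v = inverse q * kern (inverse q) v u"
proof -
  have "(u - v) * (v - q * u) = q * ((v - u) * (u - inverse q * v))"
    using assms by (simp add: field_simps)
  then show ?thesis by (simp add: kern_def)
qed

text \<open>Exchanging the arguments of the kernel inverts q up to a factor
  (\<open>kern_inverse\<close>), so this is the left version for \<open>inverse q\<close>, whose
  poles r / q turn into q r.\<close>

lemma kern_partial_fractions_right:
  fixes z q :: "'a::field"
  assumes fin: "finite I" and q: "q \<noteq> 0" and I0: "0 \<notin> I"
    and neq: "\<forall>i\<in>I. \<forall>j\<in>I. i \<noteq> q * j"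
    and z: "z \<noteq> 0" "z \<notin> I" "\<And>i. i \<in> I \<Longrightarrow> z \<noteq> q * i"
    and b: "- 1 \<le> b" "b < 2 * int (card I)"
  shows "z powi b * (\<Prod>i\<in>I. kern q i z) =
    (\<Sum>r\<in>I. (q * r) powi b / (r - q * r) * (\<Prod>i\<in>I - {r}. kern q i (q * r)) / (z - q * r)
        - r powi b / (r - q * r) * (\<Prod>i\<in>I - {r}. kern q i r) / (z - r))
    + (if b = - 1 then \<Prod>i\<in>I. kern q i 0 else 0) / z"
proof -
  let ?q = "inverse q"
  have kern: "(\<Prod>i\<in>X. kern q i w) = ?q ^ card X * (\<Prod>i\<in>X. kern ?q w i)" for X w
    by (simp add: kern_inverse[OF q, of _ w] prod.distrib)
  have neq': "\<forall>i\<in>I. \<forall>j\<in>I. i \<noteq> ?q * j"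
    using neq q by (auto simp: field_simps)
  have q': "?q \<noteq> 0" using q by simp
  have z': "?q * z \<notin> I" 
  proof
    assume "?q * z \<in> I"
    from z(3)[OF this] show False using q by simp
  qed
  have L: "z powi b * (\<Prod>i\<in>I. kern q i z) = ?q ^ card I * (z powi b * (\<Prod>i\<in>I. kern ?q z i))"
    by (simp add: kern)
  have e: "r / ?q = q * r" for r by (simp add: divide_inverse)
  \<comment> \<open>One summand of the left version for \<open>inverse q\<close>. Of the
    \<open>card I\<close> factors \<open>inverse q\<close>, one turns the denominator r - r / q into
    r - q r with a change of sign, which exchanges the positive and the negative term.\<close>
  have *: "?q ^ card I * (r powi b / (r - ?q * r) * P / (z - r) - (q * r) powi b / (r - ?q * r) * Q / (z - q * r)) =
     (q * r) powi b / (r - q * r) * (?q ^ card (I - {r}) * Q) / (z - q * r) - 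
       r powi b / (r - q * r) * (?q ^ card (I - {r}) * P) / (z - r)" if r: "r \<in> I" for r P Q
  proof -
    have "card I = Suc (card (I - {r}))" by (rule card.remove[OF fin r])
    then have c: "?q ^ card I = ?q * ?q ^ card (I - {r})" by simp
    have "r \<noteq> 0" "r - q * r \<noteq> 0" using I0 r neq by auto
    then have d: "?q / (r - ?q * r) = - (1 / (r - q * r))"
      using q by (auto simp: divide_simps algebra_simps)
    have "?q ^ card I * (r powi b / (r - ?q * r) * P / (z - r) - (q * r) powi b / (r - ?q * r) * Q / (z - q * r)) =
       (?q / (r - ?q * r)) * (?q ^ card (I - {r}) * (r powi b * P / (z - r) - (q * r) powi b * Q / (z - q * r)))"
      unfolding c by (simp add: divide_inverse algebra_simps)
    then show ?thesis unfolding d by (simp add: divide_inverse algebra_simps)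
  qed
  show ?thesis
    unfolding L kern_partial_fractions_left[OF fin q' I0 neq' z(1,2) z' b] distrib_left sum_distrib_left
    by (intro arg_cong2[where f = "(+)"] sum.cong refl) (simp_all only: e * kern, simp)
qed

section \<open>Sums over subsets of fixed size\<close>

definition subset_term :: "'a::field \<Rightarrow> int \<Rightarrow> int \<Rightarrow> 'a set \<Rightarrow> 'a set \<Rightarrow> 'a"
  where "subset_term q a b I J = \<Prod>I powi a * \<Prod>J powi b * (\<Prod>i\<in>I. \<Prod>j\<in>J. kern q i j)"

text \<open>
  The variables are the elements of a set \<open>S\<close> of field elements, so that no family
  \<open>x\<^sub>1, x\<^sub>2, \<dots>\<close> has to be carried along.
\<close>

definition subset_sum :: "'a::field \<Rightarrow> 'a set \<Rightarrow> nat \<Rightarrow> int \<Rightarrow> int \<Rightarrow> 'a"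
  where "subset_sum q S k a b = (\<Sum>I | I \<subseteq> S \<and> card I = k. subset_term q a b I (S - I))"

text \<open>Separates the poles in one variable: those at elements of \<open>S\<close> differ from 0
  and from those at multiples of elements by q or 1/q. The case \<open>x = y\<close> excludes q = 1
  for nonempty \<open>S\<close>.\<close>

definition generic :: "'a::field \<Rightarrow> 'a set \<Rightarrow> bool"
  where "generic q S \<longleftrightarrow> finite S \<and> q \<noteq> 0 \<and> 0 \<notin> S \<and> (\<forall>x\<in>S. \<forall>y\<in>S. x \<noteq> q * y)"

text \<open>
  Up to powers of \<open>q\<close> (and a sign), \<open>pole_coeff q R (a + b) r w\<close> is the residue at \<open>z = q r\<close> for
  \<open>w = r\<close>, and at \<open>z = r / q\<close> for \<open>w = r / q\<close>; it does not depend on the size of the subsets.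
\<close>

definition pole_coeff :: "'a::field \<Rightarrow> 'a set \<Rightarrow> int \<Rightarrow> 'a \<Rightarrow> 'a \<Rightarrow> 'a"
  where "pole_coeff q R c r w = r powi c / (r - q * r) * (\<Prod>s\<in>R - {r}. kern q w s)"

lemma generic_subset: "generic q S \<Longrightarrow> T \<subseteq> S \<Longrightarrow> generic q T"
  unfolding generic_def using finite_subset by blast

lemma subset_term_insert_left:
  assumes "finite I" "z \<notin> I"
  shows "subset_term q a b (insert z I) J = subset_term q a b I J * (z powi a * (\<Prod>j\<in>J. kern q z j))"
  using assms by (simp add: subset_term_def power_int_mult_distrib mult_ac)

lemma subset_term_insert_right:
  assumes "finite J" "z \<notin> J"
  shows "subset_term q a b I (insert z J) = subset_term q a b I J * (z powi b * (\<Prod>i\<in>I. kern q i z))"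
  using assms by (simp add: subset_term_def power_int_mult_distrib prod.distrib mult_ac)

section \<open>Reindexing sums over subsets\<close>

lemma sum_subsets_insert:
  assumes "finite R" "z \<notin> R"
  shows "(\<Sum>I | I \<subseteq> insert z R \<and> card I = Suc k. f I) =
    (\<Sum>I | I \<subseteq> R \<and> card I = k. f (insert z I)) + (\<Sum>I | I \<subseteq> R \<and> card I = Suc k. f I)"
proof -
  let ?P = "\<lambda>k. {I. I \<subseteq> R \<and> card I = k}"
  have fin: "finite I" if "I \<subseteq> R" for I using that assms(1) finite_subset by blast
  have "{I. I \<subseteq> insert z R \<and> card I = Suc k} = insert z ` ?P k \<union> ?P (Suc k)" (is "?A = ?B")
  proof (intro set_eqI iffI)
    fix I assume I: "I \<in> ?A"
    show "I \<in> ?B"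
    proof (cases "z \<in> I")
      case True
      then have "I = insert z (I - {z})" "I - {z} \<subseteq> R" using I by auto
      moreover have "card (I - {z}) = k" using True I by simp
      ultimately show ?thesis by blast
    qed (use I in auto)
  next
    fix I assume "I \<in> ?B"
    then show "I \<in> ?A" using assms(2) fin by (auto simp: card_insert_if)
  qed
  moreover have "inj_on (insert z) (?P k)" using assms(2) by (auto intro!: inj_onI)
  moreover have "insert z ` ?P k \<inter> ?P (Suc k) = {}" using assms(2) by auto
  ultimately show ?thesis
    using assms(1) by (simp add: sum.union_disjoint sum.reindex)
qed

text \<open>Together with \<open>sum_subsets_swap_in\<close> this makes both kinds of pole terms run
  over the same sets \<open>I\<close> inside \<open>R - {r}\<close>. The common index pairs
  \<open>insert z I\<close> with \<open>insert r I\<close>, the two sets whose poles at z = r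
  cancel.\<close>

lemma sum_subsets_swap_out:
  assumes "finite R"
  shows "(\<Sum>I | I \<subseteq> R \<and> card I = k. \<Sum>r\<in>R - I. f I r) =
    (\<Sum>r\<in>R. \<Sum>I | I \<subseteq> R - {r} \<and> card I = k. f I r)"
proof -
  have "(\<Sum>I | I \<subseteq> R \<and> card I = k. \<Sum>r\<in>R - I. f I r) =
      (\<Sum>I\<in>{I. I \<subseteq> R \<and> card I = k}. \<Sum>r | r \<in> R \<and> r \<notin> I. f I r)"
    by (intro sum.cong) auto
  also have "\<dots> = (\<Sum>r\<in>R. \<Sum>I | I \<in> {I. I \<subseteq> R \<and> card I = k} \<and> r \<notin> I. f I r)"
    using assms by (intro sum.swap_restrict) auto
  also have "\<dots> = (\<Sum>r\<in>R. \<Sum>I | I \<subseteq> R - {r} \<and> card I = k. f I r)"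
    by (intro sum.cong) auto
  finally show ?thesis .
qed

lemma sum_subsets_swap_in:
  assumes "finite R"
  shows "(\<Sum>I | I \<subseteq> R \<and> card I = Suc k. \<Sum>r\<in>I. f I r) =
    (\<Sum>r\<in>R. \<Sum>I | I \<subseteq> R - {r} \<and> card I = k. f (insert r I) r)"
proof -
  have "(\<Sum>I | I \<subseteq> R \<and> card I = Suc k. \<Sum>r\<in>I. f I r) =
      (\<Sum>I\<in>{I. I \<subseteq> R \<and> card I = Suc k}. \<Sum>r | r \<in> R \<and> r \<in> I. f I r)"
    by (intro sum.cong) auto
  also have "\<dots> = (\<Sum>r\<in>R. \<Sum>I | I \<in> {I. I \<subseteq> R \<and> card I = Suc k} \<and> r \<in> I. f I r)"
    using assms by (intro sum.swap_restrict) auto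
  also have "\<dots> = (\<Sum>r\<in>R. \<Sum>I | I \<subseteq> R - {r} \<and> card I = k. f (insert r I) r)"
  proof (intro sum.cong[OF refl])
    fix r assume r: "r \<in> R"
    have "{I \<in> {I. I \<subseteq> R \<and> card I = Suc k}. r \<in> I} = insert r ` {I. I \<subseteq> R - {r} \<and> card I = k}" (is "?A = ?B")
    proof (intro set_eqI iffI)
      fix I assume I: "I \<in> ?A"
      then have "I = insert r (I - {r})" "I - {r} \<subseteq> R - {r}" by auto
      moreover have "card (I - {r}) = k" using I by simp
      ultimately show "I \<in> ?B" by blast
    next
      fix I assume "I \<in> ?B"
      then obtain I' where I': "I = insert r I'" "I' \<subseteq> R - {r}" "card I' = k" by blast
      moreover have "finite I'" using I'(2) assms finite_subset by blast
      ultimately show "I \<in> ?A" using r by (auto simp: card_insert_if)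
    qed
    moreover have "inj_on (insert r) {I. I \<subseteq> R - {r} \<and> card I = k}" by (auto intro!: inj_onI)
    ultimately show "(\<Sum>I | I \<in> {I. I \<subseteq> R \<and> card I = Suc k} \<and> r \<in> I. f I r) =
        (\<Sum>I | I \<subseteq> R - {r} \<and> card I = k. f (insert r I) r)"
      by (simp add: sum.reindex)
  qed
  finally show ?thesis .
qed

section \<open>Recursion on the number of variables\<close>

text \<open>Scaling by q exchanges the two linear factors of the denominator. Thus at z = q r or z =
  r / q the kernels with \<open>I\<close> and those with the complement all take the form
  \<open>kern q w s\<close> for one and the same w, and the residue depends on the splitting of
  \<open>R - {r}\<close> only through a power of q.\<close>

lemma kern_swap:
  assumes "q \<noteq> 0"
  shows "kern q i (q * r) = inverse q * kern q r i" "kern q i r = inverse q * kern q (r / q) i"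
proof -
  have "(i - q * r) * (q * r - q * i) = q * ((r - i) * (i - q * r))" by (simp add: algebra_simps)
  then show "kern q i (q * r) = inverse q * kern q r i" by (simp only: kern_def inverse_mult_distrib)
  have "(i - r) * (r - q * i) = q * ((r / q - i) * (i - q * (r / q)))" using assms by (simp add: field_simps)
  then show "kern q i r = inverse q * kern q (r / q) i" by (simp only: kern_def inverse_mult_distrib)
qed

text \<open>The first summand belongs to the set \<open>insert z I\<close>, the second to
  \<open>insert r I\<close> with z in the complement. Their residues at z = r are opposite; at the
  other two poles \<open>kern_swap\<close> merges the kernels over \<open>I\<close> and
  \<open>J\<close> into one product over \<open>R - {r}\<close>, at the price of a factor
  \<open>inverse q ^ k\<close>.\<close>

lemma subset_sum_pole_terms:
  assumes gen: "generic q R" and r: "r \<in> R" and I: "I \<subseteq> R - {r}" "card I = k"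
    and J: "J = R - {r} - I"
  shows "subset_term q a b I (insert r J) *
        (r powi a / (r - q * r) * (\<Prod>j\<in>J. kern q r j) / (z - r)
          - (r / q) powi a / (r - q * r) * (\<Prod>j\<in>J. kern q (r / q) j) / (z - r / q)) +
      subset_term q a b (insert r I) J *
        ((q * r) powi b / (r - q * r) * (\<Prod>i\<in>I. kern q i (q * r)) / (z - q * r)
          - r powi b / (r - q * r) * (\<Prod>i\<in>I. kern q i r) / (z - r)) =
    (q powi (b - int k) * pole_coeff q R (a + b) r r / (z - q * r)
      - q powi (- a - int k) * pole_coeff q R (a + b) r (r / q) / (z - r / q)) * subset_term q a b I J"
proof -
  have q: "q \<noteq> 0" and r0: "r \<noteq> 0" and fin: "finite R" using gen r by (auto simp: generic_def)
  have finI: "finite I" and finJ: "finite J" using I J fin finite_subset by auto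
  have rI: "r \<notin> I" "r \<notin> J" using I J by auto
  have IJ: "R - {r} = I \<union> J" "I \<inter> J = {}" using I J by auto
  have pc: "pole_coeff q R (a + b) r w =
      r powi (a + b) / (r - q * r) * ((\<Prod>i\<in>I. kern q w i) * (\<Prod>j\<in>J. kern q w j))" for w
    unfolding pole_coeff_def IJ(1) by (simp add: prod.union_disjoint[OF finI finJ IJ(2)])
  have ka: "(\<Prod>i\<in>I. kern q i (q * r)) = inverse q ^ k * (\<Prod>i\<in>I. kern q r i)"
    by (simp only: kern_swap(1)[OF q] prod.distrib prod_constant I(2))
  have kb: "(\<Prod>i\<in>I. kern q i r) = inverse q ^ k * (\<Prod>i\<in>I. kern q (r / q) i)"
    by (subst kern_swap(2)[OF q]) (simp only: prod.distrib prod_constant I(2))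
  have pa: "q powi (b - int k) = q powi b * inverse q ^ k" 
    and pb: "q powi (- a - int k) = inverse (q powi a) * inverse q ^ k"
    using q by (simp_all add: power_int_diff power_int_minus divide_inverse power_inverse)
  have pr: "r powi (a + b) = r powi a * r powi b" using r0 by (simp add: power_int_add)
  have pq: "(r / q) powi a = r powi a * inverse (q powi a)" "(q * r) powi b = q powi b * r powi b"
    by (simp_all add: power_int_divide_distrib power_int_mult_distrib divide_inverse power_int_inverse)
  define X where "X = (\<Prod>i\<in>I. kern q i r)"
  have k1: "subset_term q a b I (insert r J) = subset_term q a b I J * (r powi b * X)"
    and k2: "subset_term q a b (insert r I) J = subset_term q a b I J * (r powi a * (\<Prod>j\<in>J. kern q r j))"
    by (simp_all only: subset_term_insert_left[OF finI rI(1)] subset_term_insert_right[OF finJ rI(2)] X_def)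
  \<comment> \<open>The fractions over \<open>z - r\<close> drop out: both numerators consist of the
    two powers of r and the kernels of r with \<open>I\<close> and with \<open>J\<close>.\<close>
  have "subset_term q a b I (insert r J) *
        (r powi a / (r - q * r) * (\<Prod>j\<in>J. kern q r j) / (z - r)
          - (r / q) powi a / (r - q * r) * (\<Prod>j\<in>J. kern q (r / q) j) / (z - r / q)) +
      subset_term q a b (insert r I) J *
        ((q * r) powi b / (r - q * r) * (\<Prod>i\<in>I. kern q i (q * r)) / (z - q * r)
          - r powi b / (r - q * r) * X / (z - r)) =
      (r powi a * (\<Prod>j\<in>J. kern q r j) * ((q * r) powi b / (r - q * r) * (\<Prod>i\<in>I. kern q i (q * r)) / (z - q * r))
       - r powi b * X * ((r / q) powi a / (r - q * r) * (\<Prod>j\<in>J. kern q (r / q) j) / (z - r / q))) * subset_term q a b I J"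
    unfolding k1 k2 by (simp only: divide_inverse) (simp only: algebra_simps)
  then show ?thesis
    unfolding X_def pc ka kb pa pb pr pq by (simp only: divide_inverse mult_ac)
qed

text \<open>The sets are split by membership of z, the factor containing z is expanded in partial
  fractions, and the poles are paired. The bounds on \<open>a\<close> and \<open>b\<close> are the
  degree conditions for a complement of size \<open>card R - k\<close> and for a set of size
  \<open>Suc k\<close>. The last line is the pole at z = 0.\<close>

lemma subset_sum_insert:
  assumes gen: "generic q (insert z R)" and z: "z \<notin> R"
    and a: "- 1 \<le> a" "a < 2 * (int (card R) - int k)" and b: "- 1 \<le> b" "b < 2 * (int k + 1)"
  shows "subset_sum q (insert z R) (Suc k) a b =
    (\<Sum>r\<in>R. (q powi (b - int k) * pole_coeff q R (a + b) r r / (z - q * r)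
        - q powi (- a - int k) * pole_coeff q R (a + b) r (r / q) / (z - r / q))
        * subset_sum q (R - {r}) k a b)
    + ((if a = - 1 then (- 1) ^ (card R - k) * subset_sum q R k (- 1) (b - 2) else 0)
      + (if b = - 1 then (- inverse q) ^ Suc k * subset_sum q R (Suc k) (a - 2) (- 1) else 0)) / z"
proof -
  let ?P = "\<lambda>k. {I. I \<subseteq> R \<and> card I = k}"
  have gR: "generic q R" using generic_subset[OF gen] by blast
  have fin: "finite R" and q: "q \<noteq> 0" and R0: "0 \<notin> R" and z0: "z \<noteq> 0"
    using gen by (auto simp: generic_def)
  have neq: "\<forall>x\<in>insert z R. \<forall>y\<in>insert z R. x \<noteq> q * y" using gen by (simp add: generic_def)
  have finI: "finite I" if "I \<subseteq> R" for I using that fin finite_subset by blast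
  \<comment> \<open>Meant for z = 0, where by \<open>k0\<close> each kernel is a constant times an
    inverse square, so that an exponent drops by two.\<close>
  have pinv: "\<Prod>X powi c * (\<Prod>x\<in>X. e * inverse (x * x)) = e ^ card X * \<Prod>X powi (c - 2)"
    if "X \<subseteq> R" for X c e
  proof -
    have "\<Prod>X \<noteq> 0" using that R0 finI[OF that] by auto
    then have "\<Prod>X powi (c - 2) = \<Prod>X powi c * inverse (\<Prod>X * \<Prod>X)"
      by (simp add: power_int_diff divide_inverse power2_eq_square)
    moreover have "(\<Prod>x\<in>X. e * inverse (x * x)) = e ^ card X * inverse (\<Prod>X * \<Prod>X)"
      by (simp add: prod.distrib prod_inversef[symmetric] o_def)
    ultimately show ?thesis by simp
  qed
  have k0: "kern q 0 j = - 1 * inverse (j * j)" "kern q i 0 = - inverse q * inverse (i * i)" for i j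
    by (simp_all add: kern_def mult_ac)
  have c1: "subset_term q (- 1) b I (R - I) * (\<Prod>j\<in>R - I. kern q 0 j) = (- 1) ^ (card R - k) * subset_term q (- 1) (b - 2) I (R - I)"
    if "I \<in> ?P k" for I
  proof -
    have "card (R - I) = card R - k" using that finI by (auto simp: card_Diff_subset)
    then have "\<Prod>(R - I) powi b * (\<Prod>j\<in>R - I. kern q 0 j) = (- 1) ^ (card R - k) * \<Prod>(R - I) powi (b - 2)"
      using pinv[OF Diff_subset, of I b "- 1"] unfolding k0(1) by simp
    then have "\<Prod>I powi (- 1) * (\<Prod>i\<in>I. \<Prod>j\<in>R - I. kern q i j) * (\<Prod>(R - I) powi b * (\<Prod>j\<in>R - I. kern q 0 j)) =
        \<Prod>I powi (- 1) * (\<Prod>i\<in>I. \<Prod>j\<in>R - I. kern q i j) * ((- 1) ^ (card R - k) * \<Prod>(R - I) powi (b - 2))"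
      by (rule arg_cong)
    then show ?thesis unfolding subset_term_def by (simp only: mult_ac)
  qed
  have c2: "subset_term q a (- 1) I (R - I) * (\<Prod>i\<in>I. kern q i 0) = (- inverse q) ^ Suc k * subset_term q (a - 2) (- 1) I (R - I)"
    if "I \<in> ?P (Suc k)" for I
  proof -
    have I: "I \<subseteq> R" "card I = Suc k" using that by auto
    have "\<Prod>I powi a * (\<Prod>i\<in>I. kern q i 0) = (- inverse q) ^ Suc k * \<Prod>I powi (a - 2)"
      using pinv[OF I(1), of a "- inverse q"] unfolding k0(2) I(2) .
    then have "\<Prod>(R - I) powi (- 1) * (\<Prod>i\<in>I. \<Prod>j\<in>R - I. kern q i j) * (\<Prod>I powi a * (\<Prod>i\<in>I. kern q i 0)) =
        \<Prod>(R - I) powi (- 1) * (\<Prod>i\<in>I. \<Prod>j\<in>R - I. kern q i j) * ((- inverse q) ^ Suc k * \<Prod>I powi (a - 2))"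
      by (rule arg_cong)
    then show ?thesis unfolding subset_term_def by (simp only: mult_ac)
  qed
  define f where "f I r = r powi a / (r - q * r) * (\<Prod>j\<in>R - I - {r}. kern q r j) / (z - r)
          - (r / q) powi a / (r - q * r) * (\<Prod>j\<in>R - I - {r}. kern q (r / q) j) / (z - r / q)" for I r
  define g where "g I r = (q * r) powi b / (r - q * r) * (\<Prod>i\<in>I - {r}. kern q i (q * r)) / (z - q * r)
          - r powi b / (r - q * r) * (\<Prod>i\<in>I - {r}. kern q i r) / (z - r)" for I r
  \<comment> \<open>Here z belongs to the set and is a first argument of the kernels; in
    \<open>s2\<close> it lies in the complement and is a second argument.\<close>
  have s1: "subset_term q a b (insert z I) (insert z R - insert z I) =
      (\<Sum>r\<in>R - I. subset_term q a b I (R - I) * f I r) +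
      (if a = - 1 then (- 1) ^ (card R - k) * subset_term q (- 1) (b - 2) I (R - I) else 0) / z" if I: "I \<in> ?P k" for I
  proof -
    have IR: "I \<subseteq> R" and cI: "card I = k" using I by auto
    have zI: "z \<notin> I" using z IR by auto
    have D: "insert z R - insert z I = R - I" using z by auto
    have cd: "a < 2 * int (card (R - I))"
      using a(2) IR cI finI[OF IR] card_mono[OF fin IR] by (simp add: card_Diff_subset)
    have pf: "z powi a * (\<Prod>j\<in>R - I. kern q z j) =
        (\<Sum>r\<in>R - I. f I r) + (if a = - 1 then \<Prod>j\<in>R - I. kern q 0 j else 0) / z"
      unfolding f_def by (rule kern_partial_fractions_left) (use fin q R0 neq z z0 a(1) cd in auto)
    show ?thesis
      unfolding D subset_term_insert_left[OF finI[OF IR] zI] pf distrib_left sum_distrib_left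
      using c1[OF I] by simp
  qed
  have s2: "subset_term q a b I (insert z R - I) =
      (\<Sum>r\<in>I. subset_term q a b I (R - I) * g I r) +
      (if b = - 1 then (- inverse q) ^ Suc k * subset_term q (a - 2) (- 1) I (R - I) else 0) / z" if I: "I \<in> ?P (Suc k)" for I
  proof -
    have IR: "I \<subseteq> R" and cI: "card I = Suc k" using I by auto
    have D: "insert z R - I = insert z (R - I)" using z IR by auto
    have finD: "finite (R - I)" and zD: "z \<notin> R - I" using fin z by auto
    have pf: "z powi b * (\<Prod>i\<in>I. kern q i z) =
        (\<Sum>r\<in>I. g I r) + (if b = - 1 then \<Prod>i\<in>I. kern q i 0 else 0) / z"
      unfolding g_def
      by (rule kern_partial_fractions_right) (use finI[OF IR] IR q R0 neq z z0 b cI in auto)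
    show ?thesis
      unfolding D subset_term_insert_right[OF finD zD] pf distrib_left sum_distrib_left
      using c2[OF I] by simp
  qed
  let ?C1 = "\<Sum>I\<in>?P k. (if a = - 1 then (- 1) ^ (card R - k) * subset_term q (- 1) (b - 2) I (R - I) else 0) / z"
  let ?C2 = "\<Sum>I\<in>?P (Suc k). (if b = - 1 then (- inverse q) ^ Suc k * subset_term q (a - 2) (- 1) I (R - I) else 0) / z"
  have "subset_sum q (insert z R) (Suc k) a b =
      (\<Sum>I\<in>?P k. subset_term q a b (insert z I) (insert z R - insert z I)) +
      (\<Sum>I\<in>?P (Suc k). subset_term q a b I (insert z R - I))"
    unfolding subset_sum_def by (rule sum_subsets_insert[OF fin z])
  also have "\<dots> = ((\<Sum>I\<in>?P k. \<Sum>r\<in>R - I. subset_term q a b I (R - I) * f I r) + ?C1) +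
      ((\<Sum>I\<in>?P (Suc k). \<Sum>r\<in>I. subset_term q a b I (R - I) * g I r) + ?C2)"
    by (simp only: s1 s2 sum.distrib cong: sum.cong)
  also have "\<dots> = ((\<Sum>I\<in>?P k. \<Sum>r\<in>R - I. subset_term q a b I (R - I) * f I r) +
      (\<Sum>I\<in>?P (Suc k). \<Sum>r\<in>I. subset_term q a b I (R - I) * g I r)) + (?C1 + ?C2)"
    by (simp only: add_ac)
  also have "?C1 + ?C2 = ((if a = - 1 then (- 1) ^ (card R - k) * subset_sum q R k (- 1) (b - 2) else 0)
      + (if b = - 1 then (- inverse q) ^ Suc k * subset_sum q R (Suc k) (a - 2) (- 1) else 0)) / z"
    by (simp add: subset_sum_def sum_distrib_left sum_divide_distrib add_divide_distrib)
  also have "(\<Sum>I\<in>?P k. \<Sum>r\<in>R - I. subset_term q a b I (R - I) * f I r) +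
      (\<Sum>I\<in>?P (Suc k). \<Sum>r\<in>I. subset_term q a b I (R - I) * g I r) =
      (\<Sum>r\<in>R. \<Sum>I | I \<subseteq> R - {r} \<and> card I = k. subset_term q a b I (R - I) * f I r +
        subset_term q a b (insert r I) (R - insert r I) * g (insert r I) r)"
    unfolding sum_subsets_swap_out[OF fin] sum_subsets_swap_in[OF fin] by (simp only: sum.distrib)
  also have "\<dots> = (\<Sum>r\<in>R. (q powi (b - int k) * pole_coeff q R (a + b) r r / (z - q * r)
        - q powi (- a - int k) * pole_coeff q R (a + b) r (r / q) / (z - r / q))
        * subset_sum q (R - {r}) k a b)"
    unfolding subset_sum_def sum_distrib_left
  proof (intro sum.cong refl)
    fix r I assume r: "r \<in> R" and "I \<in> {I. I \<subseteq> R - {r} \<and> card I = k}"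
    then have I: "I \<subseteq> R - {r}" "card I = k" by auto
    have D: "R - I = insert r (R - {r} - I)" "R - I - {r} = R - {r} - I"
      "R - insert r I = R - {r} - I" "insert r I - {r} = I" using r I by auto
    show "subset_term q a b I (R - I) * f I r + subset_term q a b (insert r I) (R - insert r I) * g (insert r I) r =
      (q powi (b - int k) * pole_coeff q R (a + b) r r / (z - q * r)
        - q powi (- a - int k) * pole_coeff q R (a + b) r (r / q) / (z - r / q)) * subset_term q a b I (R - {r} - I)"
      unfolding f_def g_def D(2-4) unfolding D(1)
      by (rule subset_sum_pole_terms[OF gR r I refl])
  qed
  finally show ?thesis .
qed

section \<open>The two relations for sums over subsets\<close>

text \<open>Every variable lies in \<open>I\<close> or in its complement, so a common shift of both
  exponents factors out of each term. This reduces the relations to a single value of n.\<close>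

lemma subset_sum_shift:
  assumes "finite S" "0 \<notin> S"
  shows "subset_sum q S k (a + c) (b + c) = \<Prod>S powi c * subset_sum q S k a b"
  unfolding subset_sum_def sum_distrib_left
proof (intro sum.cong refl)
  fix I assume "I \<in> {I. I \<subseteq> S \<and> card I = k}"
  then have I: "I \<subseteq> S" by simp
  then have fin: "finite I" "finite (S - I)" using assms finite_subset by auto
  have "\<Prod>I \<noteq> 0" "\<Prod>(S - I) \<noteq> 0" using fin assms I by auto
  moreover have "\<Prod>S = \<Prod>I * \<Prod>(S - I)"
    using prod.subset_diff[OF I assms(1), of "\<lambda>x. x"] by (simp add: mult.commute)
  ultimately show "subset_term q (a + c) (b + c) I (S - I) = \<Prod>S powi c * subset_term q a b I (S - I)"
    by (simp add: subset_term_def power_int_add power_int_mult_distrib mult_ac)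
qed

lemma subset_sum_empty: "finite S \<Longrightarrow> subset_sum q S 0 a b = \<Prod>S powi b"
proof -
  assume "finite S"
  then have "{I. I \<subseteq> S \<and> card I = 0} = {{}}" by (auto simp: card_eq_0_iff dest: finite_subset)
  then show ?thesis by (simp add: subset_sum_def subset_term_def)
qed

lemma subset_sum_full: "finite S \<Longrightarrow> subset_sum q S (card S) a b = \<Prod>S powi a"
proof -
  assume S: "finite S"
  then have "{I. I \<subseteq> S \<and> card I = card S} = {S}" by (auto dest: card_subset_eq)
  then show ?thesis by (simp add: subset_sum_def subset_term_def)
qed

text \<open>Both sides have total exponent d, so \<open>subset_sum_insert\<close> expands them with
  the same pole coefficients. The two sums over \<open>R - {r}\<close> are related by induction,
  both sizes having dropped by one.\<close>

lemma subset_sum_commute: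
  assumes "generic q S" "card S = \<alpha> + \<beta>" "\<beta> \<le> \<alpha>"
    and "- 1 \<le> d" "d \<le> 2 * (int \<alpha> - int \<beta>) + 1"
  shows "subset_sum q S \<alpha> 0 d = q powi (int \<beta> * (d - int \<alpha> + int \<beta>)) * subset_sum q S \<beta> d 0"
  using assms
proof (induction \<beta> arbitrary: \<alpha> S d)
  case 0
  then have "finite S" by (simp add: generic_def)
  then show ?case using subset_sum_full[of S q 0 d] 0 by (simp add: subset_sum_empty)
next
  case (Suc \<beta>)
  then obtain \<alpha>' where \<alpha>: "\<alpha> = Suc \<alpha>'" by (cases \<alpha>) auto
  have fin: "finite S" and q: "q \<noteq> 0" and S0: "0 \<notin> S" using Suc.prems by (auto simp: generic_def)
  have "S \<noteq> {}" using Suc.prems(2) by auto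
  then obtain z where zS: "z \<in> S" by blast
  define R where "R = S - {z}"
  have S: "S = insert z R" and z: "z \<notin> R" using zS by (auto simp: R_def)
  have cR: "card R = \<alpha>' + Suc \<beta>" using Suc.prems(2) fin zS by (simp add: R_def \<alpha>)
  have g: "generic q (insert z R)" using Suc.prems(1) S by simp
  have gR: "generic q R" using generic_subset[OF g] by blast
  have finR: "finite R" and R0: "0 \<notin> R" using gR by (auto simp: generic_def)
  \<comment> \<open>Both \<open>e\<close> and the upper bound on \<open>d\<close> depend on the
    sizes only through their difference, hence persist when each drops by one.\<close>
  define e where "e = d - int \<alpha> + int (Suc \<beta>)"
  have IH: "subset_sum q (R - {r}) \<alpha>' 0 d = q powi (int \<beta> * e) * subset_sum q (R - {r}) \<beta> d 0"
    if r: "r \<in> R" for r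
  proof -
    have "generic q (R - {r})" using generic_subset[OF gR] by blast
    moreover have "card (R - {r}) = \<alpha>' + \<beta>" using r finR cR by simp
    moreover have "e = d - int \<alpha>' + int \<beta>" by (simp add: e_def \<alpha>)
    ultimately show ?thesis
      using Suc.IH[of "R - {r}" \<alpha>' d] Suc.prems by (simp add: \<alpha>)
  qed
  \<comment> \<open>The poles at z = 0. Shifting by 2 turns the exponents (-2, -1) and (-1, -2) into
    (0, 1) and (1, 0), so the induction hypothesis applies to \<open>R\<close> itself with
    \<open>d = 1\<close> and sizes \<open>Suc \<alpha>'\<close> and \<open>\<beta>\<close>.\<close>
  have C: "(if d = - 1 then (- inverse q) ^ Suc \<alpha>' * subset_sum q R (Suc \<alpha>') (0 - 2) (- 1) else 0) =
    q powi (int (Suc \<beta>) * e) * (if d = - 1 then (- 1) ^ (card R - \<beta>) * subset_sum q R \<beta> (- 1) (0 - 2) else 0)"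
  proof (cases "d = - 1")
    case True
    have "subset_sum q R (Suc \<alpha>') 0 1 = q powi (int \<beta> * (1 - int (Suc \<alpha>') + int \<beta>)) * subset_sum q R \<beta> 1 0"
      using Suc.IH[of R "Suc \<alpha>'" 1] gR cR Suc.prems(3) by (simp add: \<alpha>)
    then have T: "subset_sum q R (Suc \<alpha>') (0 - 2) (- 1) =
        q powi (int \<beta> * (1 - int (Suc \<alpha>') + int \<beta>)) * subset_sum q R \<beta> (- 1) (0 - 2)"
      using subset_sum_shift[OF finR R0, of q "Suc \<alpha>'" 0 "- 2" 1]
        subset_sum_shift[OF finR R0, of q \<beta> 1 "- 2" 0] by simp
    have "(- inverse q) ^ Suc \<alpha>' = (- 1) ^ Suc \<alpha>' * inverse q ^ Suc \<alpha>'"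
      by (rule power_minus)
    also have "inverse q ^ Suc \<alpha>' = q powi (- int (Suc \<alpha>'))"
      by (simp only: power_int_minus power_int_of_nat power_inverse)
    finally have P: "(- inverse q) ^ Suc \<alpha>' = (- 1) ^ Suc \<alpha>' * q powi (- int (Suc \<alpha>'))" .
    have "- int (Suc \<alpha>') + int \<beta> * (1 - int (Suc \<alpha>') + int \<beta>) = int (Suc \<beta>) * e"
      using True by (simp add: e_def \<alpha> algebra_simps)
    then have E: "q powi (- int (Suc \<alpha>')) * q powi (int \<beta> * (1 - int (Suc \<alpha>') + int \<beta>)) = q powi (int (Suc \<beta>) * e)"
      using q by (simp only: power_int_add[symmetric] simp_thms)
    have "card R - \<beta> = Suc \<alpha>'" using cR by simp
    then show ?thesis
      unfolding T P E[symmetric] if_P[OF True] by (simp only: mult_ac)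
  qed simp
  \<comment> \<open>The powers of q on the two sides differ by the same factor
    \<open>q powi e\<close> at both kinds of pole, which raises \<open>int \<beta> * e\<close> to
    \<open>int (Suc \<beta>) * e\<close>.\<close>
  have E1: "q powi (d - int \<alpha>') * q powi (int \<beta> * e) = q powi (int (Suc \<beta>) * e) * q powi (0 - int \<beta>)"
    and E2: "q powi (- 0 - int \<alpha>') * q powi (int \<beta> * e) = q powi (int (Suc \<beta>) * e) * q powi (- d - int \<beta>)"
    using q by (simp_all only: power_int_add[symmetric] simp_thms)
      (simp_all add: e_def \<alpha> algebra_simps)
  have "subset_sum q S \<alpha> 0 d = (\<Sum>r\<in>R. (q powi (d - int \<alpha>') * pole_coeff q R d r r / (z - q * r)
        - q powi (- 0 - int \<alpha>') * pole_coeff q R d r (r / q) / (z - r / q))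
        * subset_sum q (R - {r}) \<alpha>' 0 d) +
      (if d = - 1 then (- inverse q) ^ Suc \<alpha>' * subset_sum q R (Suc \<alpha>') (0 - 2) (- 1) else 0) / z"
    unfolding S \<alpha>
    by (subst subset_sum_insert[OF g z]) (use Suc.prems cR \<alpha> in auto)
  also have "\<dots> = q powi (int (Suc \<beta>) * e) * ((\<Sum>r\<in>R. (q powi (0 - int \<beta>) * pole_coeff q R d r r / (z - q * r)
        - q powi (- d - int \<beta>) * pole_coeff q R d r (r / q) / (z - r / q))
        * subset_sum q (R - {r}) \<beta> d 0) +
      (if d = - 1 then (- 1) ^ (card R - \<beta>) * subset_sum q R \<beta> (- 1) (0 - 2) else 0) / z)"
    unfolding C distrib_left sum_distrib_left times_divide_eq_right
  proof (intro arg_cong2[where f = "(+)"] sum.cong refl)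
    fix r assume r: "r \<in> R"
    let ?A = "pole_coeff q R d r r / (z - q * r)" and ?B = "pole_coeff q R d r (r / q) / (z - r / q)"
    let ?T = "subset_sum q (R - {r}) \<beta> d 0"
    have "(q powi (d - int \<alpha>') * ?A - q powi (- 0 - int \<alpha>') * ?B) * (q powi (int \<beta> * e) * ?T) =
        (q powi (d - int \<alpha>') * q powi (int \<beta> * e)) * (?A * ?T) - (q powi (- 0 - int \<alpha>') * q powi (int \<beta> * e)) * (?B * ?T)"
      by (simp only: algebra_simps)
    also have "\<dots> = q powi (int (Suc \<beta>) * e) * ((q powi (0 - int \<beta>) * ?A - q powi (- d - int \<beta>) * ?B) * ?T)"
      unfolding E1 E2 by (simp only: algebra_simps)
    finally show "(q powi (d - int \<alpha>') * pole_coeff q R d r r / (z - q * r) -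
          q powi (- 0 - int \<alpha>') * pole_coeff q R d r (r / q) / (z - r / q)) * subset_sum q (R - {r}) \<alpha>' 0 d =
       q powi (int (Suc \<beta>) * e) * ((q powi (0 - int \<beta>) * pole_coeff q R d r r / (z - q * r) -
          q powi (- d - int \<beta>) * pole_coeff q R d r (r / q) / (z - r / q)) * subset_sum q (R - {r}) \<beta> d 0)"
      unfolding IH[OF r] times_divide_eq_right .
  qed
  also have "\<dots> = q powi (int (Suc \<beta>) * e) * subset_sum q S (Suc \<beta>) d 0"
    unfolding S
    by (subst subset_sum_insert[OF g z]) (use Suc.prems cR \<alpha> in auto)
  finally show ?case by (simp only: e_def)
qed

text \<open>All three pairs of exponents have sum 0 and hence the same pole coefficients, so the
  residues at q r and r / q reduce to the relation for \<open>R - {r}\<close>. The factor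
  \<open>q ^ \<alpha>\<close> evens out the powers of q, and the poles at z = 0 of the last two sums
  match each other.\<close>

lemma subset_sum_balanced:
  assumes "generic q S" "card S = 2 * \<alpha>"
  shows "subset_sum q S \<alpha> 0 0 - q ^ \<alpha> * subset_sum q S \<alpha> 1 (- 1) = subset_sum q S (Suc \<alpha>) (- 1) 1"
  using assms
proof (induction \<alpha> arbitrary: S)
  case 0
  then have "S = {}" by (simp add: generic_def)
  \<comment> \<open>Both sums on the left are 1, and the empty set has no subset with one
    element.\<close>
  then show ?case by (simp add: subset_sum_empty) (auto simp: subset_sum_def intro!: sum.neutral)
next
  case (Suc \<alpha>)
  have fin: "finite S" and q: "q \<noteq> 0" and S0: "0 \<notin> S" using Suc.prems by (auto simp: generic_def)
  have "S \<noteq> {}" using Suc.prems(2) by auto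
  then obtain z where zS: "z \<in> S" by blast
  define R where "R = S - {z}"
  have S: "S = insert z R" and z: "z \<notin> R" using zS by (auto simp: R_def)
  have cR: "card R = Suc (2 * \<alpha>)" using Suc.prems(2) fin zS by (simp add: R_def)
  have g: "generic q (insert z R)" using Suc.prems(1) S by simp
  have gR: "generic q R" using generic_subset[OF g] by blast
  have finR: "finite R" and R0: "0 \<notin> R" using gR by (auto simp: generic_def)
  let ?A = "\<lambda>r. pole_coeff q R 0 r r / (z - q * r)"
  let ?B = "\<lambda>r. pole_coeff q R 0 r (r / q) / (z - r / q)"
  define W where "W r = q powi (- int \<alpha>) * ?A r - q powi (- int \<alpha>) * ?B r" for r
  have IH: "subset_sum q (R - {r}) \<alpha> 0 0 - q ^ \<alpha> * subset_sum q (R - {r}) \<alpha> 1 (- 1) =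
      subset_sum q (R - {r}) (Suc \<alpha>) (- 1) 1" if r: "r \<in> R" for r
    using Suc.IH[of "R - {r}"] generic_subset[OF gR, of "R - {r}"] r finR cR by auto
  have T1: "subset_sum q S (Suc \<alpha>) 0 0 = (\<Sum>r\<in>R. W r * subset_sum q (R - {r}) \<alpha> 0 0)"
    unfolding S W_def by (subst subset_sum_insert[OF g z]) (use cR in auto)
  have T2: "subset_sum q S (Suc \<alpha>) 1 (- 1) =
      (\<Sum>r\<in>R. (q powi (- 1 - int \<alpha>) * ?A r - q powi (- 1 - int \<alpha>) * ?B r) * subset_sum q (R - {r}) \<alpha> 1 (- 1))
      + (- inverse q) ^ Suc \<alpha> * subset_sum q R (Suc \<alpha>) (- 1) (- 1) / z"
    unfolding S W_def by (subst subset_sum_insert[OF g z]) (use cR in auto)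
  \<comment> \<open>The sign is \<open>(- 1) ^ (card R - Suc \<alpha>)\<close>. The residue at z = 0
    involves the same sum as in \<open>T2\<close>: here the second exponent drops from 1 to -1,
    there the first one does.\<close>
  have T3: "subset_sum q S (Suc (Suc \<alpha>)) (- 1) 1 =
      (\<Sum>r\<in>R. W r * subset_sum q (R - {r}) (Suc \<alpha>) (- 1) 1)
      + (- 1) ^ \<alpha> * subset_sum q R (Suc \<alpha>) (- 1) (- 1) / z"
    unfolding S W_def by (subst subset_sum_insert[OF g z]) (use cR in auto)
  have E: "q ^ Suc \<alpha> * q powi (- 1 - int \<alpha>) = q ^ \<alpha> * q powi (- int \<alpha>)"
    using q by (simp add: power_int_diff power_int_minus)
  have C: "q ^ Suc \<alpha> * (- inverse q) ^ Suc \<alpha> = - ((- 1) ^ \<alpha>)"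
  proof -
    have "q ^ Suc \<alpha> * (- inverse q) ^ Suc \<alpha> = (q * - inverse q) ^ Suc \<alpha>"
      by (rule power_mult_distrib[symmetric])
    then show ?thesis using q by simp
  qed
  have "q ^ Suc \<alpha> * subset_sum q S (Suc \<alpha>) 1 (- 1) =
      (\<Sum>r\<in>R. W r * (q ^ \<alpha> * subset_sum q (R - {r}) \<alpha> 1 (- 1)))
      - (- 1) ^ \<alpha> * subset_sum q R (Suc \<alpha>) (- 1) (- 1) / z"
  proof -
    have "q ^ Suc \<alpha> * ((q powi (- 1 - int \<alpha>) * A - q powi (- 1 - int \<alpha>) * B) * T) =
        (q powi (- int \<alpha>) * A - q powi (- int \<alpha>) * B) * (q ^ \<alpha> * T)" for A B T
    proof -
      have "q ^ Suc \<alpha> * ((q powi (- 1 - int \<alpha>) * A - q powi (- 1 - int \<alpha>) * B) * T) =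
          (q ^ Suc \<alpha> * q powi (- 1 - int \<alpha>)) * ((A - B) * T)"
        by (simp only: algebra_simps)
      then show ?thesis unfolding E by (simp only: algebra_simps)
    qed
    moreover have "q ^ Suc \<alpha> * ((- inverse q) ^ Suc \<alpha> * T / z) = - ((- 1) ^ \<alpha> * T / z)" for T
    proof -
      have "q ^ Suc \<alpha> * ((- inverse q) ^ Suc \<alpha> * T / z) = (q ^ Suc \<alpha> * (- inverse q) ^ Suc \<alpha>) * T / z"
        by (simp only: mult_ac times_divide_eq_right)
      then show ?thesis unfolding C by simp
    qed
    ultimately show ?thesis
      unfolding T2 W_def distrib_left sum_distrib_left by (simp only: diff_conv_add_uminus)
  qed
  then have "subset_sum q S (Suc \<alpha>) 0 0 - q ^ Suc \<alpha> * subset_sum q S (Suc \<alpha>) 1 (- 1) =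
     (\<Sum>r\<in>R. W r * (subset_sum q (R - {r}) \<alpha> 0 0 - q ^ \<alpha> * subset_sum q (R - {r}) \<alpha> 1 (- 1)))
      + (- 1) ^ \<alpha> * subset_sum q R (Suc \<alpha>) (- 1) (- 1) / z"
    unfolding T1 by (simp only: right_diff_distrib sum_subtractf diff_diff_eq2 diff_add_eq)
  also have "\<dots> = subset_sum q S (Suc (Suc \<alpha>)) (- 1) 1"
    unfolding T3 by (simp only: IH cong: sum.cong)
  finally show ?case .
qed

section \<open>The product of two powers as a sum over subsets\<close>

lemma permutes_onto_subset:
  assumes "finite S" "A \<subseteq> S" "I \<subseteq> S" "card A = card I"
  obtains \<tau> where "\<tau> permutes S" "\<tau> ` A = I"
proof -
  have fin: "finite A" "finite I" using assms finite_subset by auto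
  obtain f where f: "bij_betw f A I"
    using finite_same_card_bij[OF fin assms(4)] by blast
  have "card (S - A) = card (S - I)" using assms fin by (simp add: card_Diff_subset)
  then obtain g where g: "bij_betw g (S - A) (S - I)"
    using finite_same_card_bij[of "S - A" "S - I"] assms(1) by auto
  define \<tau> where "\<tau> x = (if x \<in> A then f x else if x \<in> S then g x else x)" for x
  have A: "bij_betw \<tau> A I" using f by (simp add: \<tau>_def cong: bij_betw_cong)
  have "bij_betw \<tau> (S - A) (S - I)"
    using g by (subst bij_betw_cong[where g = g]) (auto simp: \<tau>_def)
  then have "bij_betw \<tau> (A \<union> (S - A)) (I \<union> (S - I))" by (intro bij_betw_combine[OF A]) auto
  moreover have "A \<union> (S - A) = S" "I \<union> (S - I) = S" using assms by auto
  ultimately have "\<tau> permutes S" using assms(2) by (intro bij_imp_permutes) (auto simp: \<tau>_def)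
  then show ?thesis using that A by (auto simp: bij_betw_def)
qed

text \<open>Composition with a permutation carrying \<open>I\<close> to another subset of the same
  size is a bijection between the two classes. So all classes are equally large, and their number is
  a binomial coefficient.\<close>

lemma card_permutes_onto:
  assumes S: "finite S" and A: "A \<subseteq> S" and I: "I \<subseteq> S" "card I = card A"
  shows "card {\<sigma>. \<sigma> permutes S \<and> \<sigma> ` A = I} = fact (card A) * fact (card S - card A)"
proof -
  let ?c = "\<lambda>I. card {\<sigma>. \<sigma> permutes S \<and> \<sigma> ` A = I}"
  let ?P = "{I. I \<subseteq> S \<and> card I = card A}"
  have c: "?c I' = ?c I" if I': "I' \<in> ?P" for I'
  proof -
    obtain \<tau> where \<tau>: "\<tau> permutes S" "\<tau> ` I = I'"
      by (rule permutes_onto_subset[OF S I(1), of I']) (use I' I(2) in auto)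
    note inv = permutes_inverses[OF \<tau>(1)]
    have "bij_betw ((\<circ>) \<tau>) {\<sigma>. \<sigma> permutes S \<and> \<sigma> ` A = I} {\<sigma>. \<sigma> permutes S \<and> \<sigma> ` A = I'}"
    proof (rule bij_betwI[where g = "(\<circ>) (inv \<tau>)"])
      show "(\<circ>) \<tau> \<in> {\<sigma>. \<sigma> permutes S \<and> \<sigma> ` A = I} \<rightarrow> {\<sigma>. \<sigma> permutes S \<and> \<sigma> ` A = I'}"
        using \<tau> by (auto simp: permutes_compose image_comp[symmetric])
      have "inv \<tau> ` I' = I"
        unfolding \<tau>(2)[symmetric] by (simp add: image_image inv)
      then show "(\<circ>) (inv \<tau>) \<in> {\<sigma>. \<sigma> permutes S \<and> \<sigma> ` A = I'} \<rightarrow> {\<sigma>. \<sigma> permutes S \<and> \<sigma> ` A = I}"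
        using permutes_inv[OF \<tau>(1)] by (auto simp: permutes_compose image_comp[symmetric])
    qed (simp_all add: fun_eq_iff inv)
    then show ?thesis by (simp add: bij_betw_same_card)
  qed
  have le: "card A \<le> card S" using A S by (rule card_mono[rotated])
  have "fact (card S) = (\<Sum>\<sigma> | \<sigma> permutes S. (1::nat))"
    using card_permutations[OF refl S] by simp
  also have "\<dots> = (\<Sum>I\<in>?P. \<Sum>\<sigma> | \<sigma> \<in> {\<sigma>. \<sigma> permutes S} \<and> \<sigma> ` A = I. 1)"
    by (rule sum.group[symmetric])
      (use S in \<open>auto simp: finite_permutations card_image[OF permutes_inj_on] permutes_in_image subsetD[OF A]\<close>)
  also have "\<dots> = (\<Sum>I'\<in>?P. ?c I)"
    by (intro sum.cong refl) (use c in simp)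
  also have "\<dots> = (card S choose card A) * ?c I"
    by (simp add: n_subsets[OF S])
  finally have "fact (card A) * fact (card S - card A) * (card S choose card A) = (card S choose card A) * ?c I"
    by (simp only: binomial_fact_lemma[OF le])
  then show ?thesis using le by simp
qed

text \<open>Serves to evaluate \<open>Sym\<close> on an integrand that sees a permutation only
  through one image set; the factorials are those by which \<open>star\<close> divides.\<close>

lemma sum_permutes_image:
  fixes h :: "'a set \<Rightarrow> 'b::semiring_1"
  assumes S: "finite S" and A: "A \<subseteq> S"
  shows "(\<Sum>\<sigma> | \<sigma> permutes S. h (\<sigma> ` A)) =
    of_nat (fact (card A)) * of_nat (fact (card S - card A)) * (\<Sum>I | I \<subseteq> S \<and> card I = card A. h I)"
proof -
  let ?P = "{I. I \<subseteq> S \<and> card I = card A}"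
  have "(\<Sum>\<sigma> | \<sigma> permutes S. h (\<sigma> ` A)) = (\<Sum>I\<in>?P. \<Sum>\<sigma> | \<sigma> \<in> {\<sigma>. \<sigma> permutes S} \<and> \<sigma> ` A = I. h (\<sigma> ` A))"
    by (rule sum.group[symmetric])
      (use S in \<open>auto simp: finite_permutations card_image[OF permutes_inj_on] permutes_in_image subsetD[OF A]\<close>)
  also have "\<dots> = (\<Sum>I\<in>?P. of_nat (fact (card A) * fact (card S - card A)) * h I)"
  proof (intro sum.cong refl)
    fix I assume "I \<in> ?P"
    then have I: "I \<subseteq> S" "card I = card A" by auto
    have "(\<Sum>\<sigma> | \<sigma> \<in> {\<sigma>. \<sigma> permutes S} \<and> \<sigma> ` A = I. h (\<sigma> ` A)) =
        (\<Sum>\<sigma> | \<sigma> permutes S \<and> \<sigma> ` A = I. h I)" by (intro sum.cong) auto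
    then show "(\<Sum>\<sigma> | \<sigma> \<in> {\<sigma>. \<sigma> permutes S} \<and> \<sigma> ` A = I. h (\<sigma> ` A)) =
        of_nat (fact (card A) * fact (card S - card A)) * h I"
      by (simp only: sum_constant card_permutes_onto[OF S A I])
  qed
  finally show ?thesis by (simp add: sum_distrib_left mult.assoc)
qed

section \<open>Characteristic zero and genericity of the variables\<close>

lemma single_neq_0: "c \<noteq> 0 \<Longrightarrow> Poly_Mapping.single a c \<noteq> 0"
  by (metis lookup_single_eq lookup_zero)

lemma single_eq_single:
  "Poly_Mapping.single a c = Poly_Mapping.single b d \<Longrightarrow> c \<noteq> 0 \<Longrightarrow> a = b \<and> c = d"
  by (metis lookup_single_eq lookup_single_not_eq)

lemma of_nat_fract: "of_nat n = to_fract (of_nat n)"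
  by (induction n) simp_all

lemma of_nat_ratfun_neq_0:
  assumes "n \<noteq> 0"
  shows "(of_nat n :: ratfun) \<noteq> 0"
proof -
  have "(of_nat n :: qrat) \<noteq> 0" using assms by (simp add: of_nat_fract[where ?'a = "complex poly"])
  then have "(of_nat n :: mpoly) \<noteq> 0" by (simp add: single_neq_0 flip: single_of_nat)
  then show ?thesis by (simp add: of_nat_fract[where ?'a = mpoly])
qed

lemma xvar_neq_0: "xvar i \<noteq> 0"
  by (simp add: xvar_def single_neq_0)

lemma inj_xvar: "inj xvar"
proof (rule injI)
  fix i j assume "xvar i = xvar j"
  then have "Poly_Mapping.single i (1::nat) = Poly_Mapping.single j 1"
    using single_eq_single by (fastforce simp: xvar_def)
  then show "i = j" using single_eq_single[of i "1::nat" j 1] by simp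
qed

lemma qq_neq_0: "qq \<noteq> 0"
  by (simp add: qq_def scal_def single_neq_0)

text \<open>Both sides are single monomials, with coefficients 1 and q; this covers
  \<open>i = j\<close> as well.\<close>

lemma xvar_neq_qq_xvar: "xvar i \<noteq> qq * xvar j"
proof
  assume "xvar i = qq * xvar j"
  then have "Poly_Mapping.single (Poly_Mapping.single i (1::nat)) (1::qrat) =
      Poly_Mapping.single (Poly_Mapping.single j 1) (to_fract [:0, 1:])"
    by (simp add: xvar_def qq_def scal_def mult_single flip: to_fract_mult)
  then have "to_fract 1 = to_fract [:0, 1::complex:]"
    using single_eq_single by fastforce
  then show False by (simp only: to_fract_eq_iff) (simp add: one_pCons)
qed

lemma generic_xvar: "finite S \<Longrightarrow> generic qq (xvar ` S)"
  using xvar_neq_qq_xvar by (auto simp: generic_def qq_neq_0 xvar_neq_0 dest: sym)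

section \<open>The product in terms of subset sums\<close>

text \<open>Each pair contributes an extra factor \<open>x i * x j\<close> besides the kernel, so
  every variable gains the size of the opposite block in its exponent.\<close>

lemma star_integrand:
  fixes x :: "'i \<Rightarrow> 'a::field"
  assumes fin: "finite I" "finite J" and inj: "inj x" and x0: "\<And>i. x i \<noteq> 0"
  shows "(\<Prod>i\<in>I. x i) powi n * (\<Prod>j\<in>J. x j) powi p /
      (\<Prod>i\<in>I. \<Prod>j\<in>J. (inverse (x j) - inverse (x i)) * (x j - q * x i)) =
    subset_term q (n + int (card J)) (p + int (card I)) (x ` I) (x ` J)"
proof -
  have k: "inverse ((inverse (x j) - inverse (x i)) * (x j - q * x i)) = x i * x j * kern q (x i) (x j)" for i j
  proof -
    have "inverse (x j) - inverse (x i) = (x i - x j) * (inverse (x i) * inverse (x j))"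
      using x0[of i] x0[of j] by (simp add: field_simps)
    then show ?thesis by (simp add: kern_def)
  qed
  have "inverse (\<Prod>i\<in>I. \<Prod>j\<in>J. (inverse (x j) - inverse (x i)) * (x j - q * x i)) =
      (\<Prod>i\<in>I. \<Prod>j\<in>J. x i * x j * kern q (x i) (x j))"
    by (simp only: prod_inversef[symmetric] o_def k)
  also have "\<dots> = (\<Prod>i\<in>I. x i) ^ card J * (\<Prod>j\<in>J. x j) ^ card I * (\<Prod>i\<in>I. \<Prod>j\<in>J. kern q (x i) (x j))"
    by (simp add: prod.distrib prod_power_distrib)
  finally have K: "inverse (\<Prod>i\<in>I. \<Prod>j\<in>J. (inverse (x j) - inverse (x i)) * (x j - q * x i)) =
      (\<Prod>i\<in>I. x i) ^ card J * (\<Prod>j\<in>J. x j) ^ card I * (\<Prod>i\<in>I. \<Prod>j\<in>J. kern q (x i) (x j))" .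
  have nz: "(\<Prod>i\<in>I. x i) \<noteq> 0" "(\<Prod>j\<in>J. x j) \<noteq> 0" using fin x0 by auto
  have im: "(\<Prod>y\<in>x ` X. f y) = (\<Prod>i\<in>X. f (x i))" for X and f :: "'a \<Rightarrow> 'a"
    by (rule prod.reindex_cong[OF inj_on_subset[OF inj]]) auto
  show ?thesis
    unfolding divide_inverse K subset_term_def im power_int_add[OF disjI1[OF nz(1)]] power_int_add[OF disjI1[OF nz(2)]]
    by (simp add: mult_ac)
qed

text \<open>After renaming by a permutation the integrand depends only on the image of
  \<open>{1..\<alpha>}\<close>; grouping the permutations by this image cancels the
  factorials.\<close>

lemma star_xpow:
  "star \<alpha> \<beta> (xpow \<alpha> n) (xpow \<beta> p) =
    subset_sum qq (xvar ` {1..\<alpha> + \<beta>}) \<alpha> (n + int \<beta>) (p + int \<alpha>)"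
proof -
  let ?S = "{1..\<alpha> + \<beta>}" and ?A = "{1..\<alpha>}"
  define R where "R = xpow \<alpha> n * ratfun_eval (\<lambda>i. xvar (\<alpha> + i)) (xpow \<beta> p) /
        (\<Prod>i\<in>{1..\<alpha>}. \<Prod>j\<in>{\<alpha> + 1..\<alpha> + \<beta>}.
           (inverse (xvar j) - inverse (xvar i)) * (xvar j - qq * xvar i))"
  define h where "h I = subset_term qq (n + int \<beta>) (p + int \<alpha>) (xvar ` I) (xvar ` (?S - I))" for I
  have SA: "?S - ?A = {\<alpha> + 1..\<alpha> + \<beta>}" by auto
  have shift: "ratfun_eval (\<lambda>i. xvar (\<alpha> + i)) (xpow \<beta> p) = (\<Prod>j\<in>?S - ?A. xvar j) powi p"
  proof -
    have inj: "inj (\<lambda>i. \<alpha> + i)" by (simp add: inj_def)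
    have "(\<lambda>i. \<alpha> + i) ` {1..\<beta>} = ?S - ?A" unfolding SA by (auto simp: image_iff intro!: bexI[of _ "_ - \<alpha>"])
    then have "(\<Prod>j\<in>?S - ?A. xvar j) = (\<Prod>i\<in>{1..\<beta>}. xvar (\<alpha> + i))"
      using prod.reindex[OF inj_on_subset[OF inj], of "{1..\<beta>}" xvar] by (simp add: o_def)
    then show ?thesis
      by (simp only: xpow_def rename_powi[OF inj] rename_prod[OF inj] rename_xvar)
  qed
  have R: "ratfun_eval (\<lambda>i. xvar (\<sigma> i)) R = h (\<sigma> ` ?A)" if \<sigma>: "\<sigma> permutes ?S" for \<sigma>
  proof -
    note inj = permutes_inj[OF \<sigma>]
    have diff: "ratfun_eval (\<lambda>i. xvar (\<sigma> i)) (r - s) = ratfun_eval (\<lambda>i. xvar (\<sigma> i)) r - ratfun_eval (\<lambda>i. xvar (\<sigma> i)) s" for r s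
      using rename_add[OF inj, of "r - s" s] by simp
    have c: "card (\<sigma> ` ?A) = \<alpha>" "card (\<sigma> ` (?S - ?A)) = \<beta>"
      unfolding SA by (simp_all add: card_image inj_on_subset[OF inj])
    have im: "?S - \<sigma> ` ?A = \<sigma> ` (?S - ?A)"
      using image_set_diff[OF inj, of ?S ?A] permutes_image[OF \<sigma>] by simp
    have re: "(\<Prod>y\<in>\<sigma> ` X. f y) = (\<Prod>i\<in>X. f (\<sigma> i))" for X and f :: "nat \<Rightarrow> ratfun"
      by (rule prod.reindex_cong[OF inj_on_subset[OF inj]]) auto
    have "ratfun_eval (\<lambda>i. xvar (\<sigma> i)) R =
      (\<Prod>i\<in>\<sigma> ` ?A. xvar i) powi n * (\<Prod>j\<in>\<sigma> ` (?S - ?A). xvar j) powi p /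
      (\<Prod>i\<in>\<sigma> ` ?A. \<Prod>j\<in>\<sigma> ` (?S - ?A). (inverse (xvar j) - inverse (xvar i)) * (xvar j - qq * xvar i))"
      unfolding R_def shift unfolding xpow_def SA[symmetric] divide_inverse re
      by (simp only: rename_mult[OF inj] rename_powi[OF inj] rename_prod[OF inj] rename_inverse[OF inj]
          rename_xvar diff qq_def rename_scal)
    also have "\<dots> = h (\<sigma> ` ?A)"
      unfolding h_def im by (subst star_integrand) (simp_all only: c inj_xvar xvar_neq_0 finite_imageI finite_Diff finite_atLeastAtMost not_False_eq_True)
    finally show ?thesis .
  qed
  have "Sym (\<alpha> + \<beta>) R = (\<Sum>\<sigma> | \<sigma> permutes ?S. h (\<sigma> ` ?A))"
    unfolding Sym_def by (intro sum.cong refl) (use R in simp)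
  also have "\<dots> = of_nat (fact \<alpha>) * of_nat (fact \<beta>) * (\<Sum>I | I \<subseteq> ?S \<and> card I = \<alpha>. h I)"
    using sum_permutes_image[of ?S ?A h] by simp
  finally have "star \<alpha> \<beta> (xpow \<alpha> n) (xpow \<beta> p) = (\<Sum>I | I \<subseteq> ?S \<and> card I = \<alpha>. h I)"
    unfolding star_def R_def[symmetric]
    using of_nat_ratfun_neq_0[OF fact_nonzero] by simp
  \<comment> \<open>Passage from sets of indices to sets of field elements, by injectivity of
    \<open>xvar\<close>.\<close>
  also have "\<dots> = subset_sum qq (xvar ` ?S) \<alpha> (n + int \<beta>) (p + int \<alpha>)"
    unfolding subset_sum_def
  proof (rule sum.reindex_cong[symmetric, where l = "image xvar"])
    note inj = inj_on_subset[OF inj_xvar subset_UNIV]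
    show "inj_on (image xvar) {I. I \<subseteq> ?S \<and> card I = \<alpha>}"
      by (auto intro!: inj_onI dest: inj_image_eq_iff[OF inj_xvar, THEN iffD1])
    show "{I. I \<subseteq> xvar ` ?S \<and> card I = \<alpha>} = image xvar ` {I. I \<subseteq> ?S \<and> card I = \<alpha>}"
    proof (intro set_eqI iffI)
      fix I assume "I \<in> {I. I \<subseteq> xvar ` ?S \<and> card I = \<alpha>}"
      then obtain I' where "I = xvar ` I'" "I' \<subseteq> ?S" "card I = \<alpha>" by (auto simp: subset_image_iff)
      then show "I \<in> image xvar ` {I. I \<subseteq> ?S \<and> card I = \<alpha>}" by (auto simp: card_image inj)
    qed (auto simp: card_image inj)
    show "subset_term qq (n + int \<beta>) (p + int \<alpha>) (xvar ` I) (xvar ` ?S - xvar ` I) = h I"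
      if "I \<in> {I. I \<subseteq> ?S \<and> card I = \<alpha>}" for I
      by (simp only: h_def image_set_diff[OF inj_xvar])
  qed
  finally show ?thesis .
qed

section \<open>The relations for the product\<close>

text \<open>Shifting by \<open>n + int \<beta>\<close> leaves the exponents 0 and
  \<open>p - n + int \<alpha> - int \<beta>\<close>; the bound on \<open>p - n\<close> translates
  exactly into the range allowed in \<open>subset_sum_commute\<close>.\<close>

lemma star_xpow_commute:
  assumes "\<beta> \<le> \<alpha>" "\<bar>p - n\<bar> \<le> int \<alpha> - int \<beta> + 1"
  shows "star \<alpha> \<beta> (xpow \<alpha> n) (xpow \<beta> p) =
    qq powi (int \<beta> * (p - n)) * star \<beta> \<alpha> (xpow \<beta> p) (xpow \<alpha> n)"
proof -
  let ?S = "xvar ` {1..\<alpha> + \<beta>}"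
  let ?d = "p - n + int \<alpha> - int \<beta>" and ?c = "n + int \<beta>"
  have gen: "generic qq ?S" by (rule generic_xvar) simp
  then have S: "finite ?S" "0 \<notin> ?S" by (simp_all add: generic_def)
  have card: "card ?S = \<alpha> + \<beta>" by (simp add: card_image inj_on_subset[OF inj_xvar])
  have "star \<alpha> \<beta> (xpow \<alpha> n) (xpow \<beta> p) = subset_sum qq ?S \<alpha> (0 + ?c) (?d + ?c)"
    by (simp add: star_xpow algebra_simps)
  also have "\<dots> = \<Prod>?S powi ?c * subset_sum qq ?S \<alpha> 0 ?d"
    by (rule subset_sum_shift[OF S])
  also have "subset_sum qq ?S \<alpha> 0 ?d = qq powi (int \<beta> * (p - n)) * subset_sum qq ?S \<beta> ?d 0"
    using subset_sum_commute[OF gen card assms(1), of ?d] assms(2) by simp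
  also have "\<Prod>?S powi ?c * (qq powi (int \<beta> * (p - n)) * subset_sum qq ?S \<beta> ?d 0) =
      qq powi (int \<beta> * (p - n)) * subset_sum qq ?S \<beta> (?d + ?c) (0 + ?c)"
    by (simp only: subset_sum_shift[OF S] mult_ac)
  also have "subset_sum qq ?S \<beta> (?d + ?c) (0 + ?c) = star \<beta> \<alpha> (xpow \<beta> p) (xpow \<alpha> n)"
    by (simp add: star_xpow algebra_simps)
  finally show ?thesis .
qed

theorem theorem7p5:
  fixes N \<alpha> \<beta> :: nat
  assumes "N \<ge> 2" and "\<alpha> \<in> {1..N - 1}" and "\<beta> \<in> {1..N - 1}"
  shows "(\<forall>n p :: int. \<bar>p - n\<bar> \<le> \<bar>int \<alpha> - int \<beta>\<bar> + 1 \<longrightarrow>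
            star \<alpha> \<beta> (xpow \<alpha> n) (xpow \<beta> p) =
              qq powi (int (min \<alpha> \<beta>) * (p - n)) * star \<beta> \<alpha> (xpow \<beta> p) (xpow \<alpha> n)) \<and>
         (\<forall>n :: int.
            qq ^ \<alpha> * star \<alpha> \<alpha> (xpow \<alpha> (n + 1)) (xpow \<alpha> (n - 1)) =
              star \<alpha> \<alpha> (xpow \<alpha> n) (xpow \<alpha> n) - star (\<alpha> + 1) (\<alpha> - 1) (xpow (\<alpha> + 1) n) (xpow (\<alpha> - 1) n))"
proof (intro conjI allI impI)
  fix n p :: int
  assume np: "\<bar>p - n\<bar> \<le> \<bar>int \<alpha> - int \<beta>\<bar> + 1"
  show "star \<alpha> \<beta> (xpow \<alpha> n) (xpow \<beta> p) =
      qq powi (int (min \<alpha> \<beta>) * (p - n)) * star \<beta> \<alpha> (xpow \<beta> p) (xpow \<alpha> n)"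
  proof (cases "\<beta> \<le> \<alpha>")
    case True
    then show ?thesis using np by (subst star_xpow_commute) (auto simp: min_def)
  next
    case False
    \<comment> \<open>The same relation with the two factors exchanged; the power of q is then moved
      to the other side.\<close>
    then have "star \<beta> \<alpha> (xpow \<beta> p) (xpow \<alpha> n) =
        qq powi (int \<alpha> * (n - p)) * star \<alpha> \<beta> (xpow \<alpha> n) (xpow \<beta> p)"
      using np by (intro star_xpow_commute) auto
    moreover have "qq powi (int \<alpha> * (p - n)) * qq powi (int \<alpha> * (n - p)) = 1"
      using qq_neq_0 by (simp add: power_int_add[symmetric] algebra_simps)
    ultimately show ?thesis using False by (simp add: mult.assoc[symmetric])
  qed
next
  fix n :: int
  let ?S = "xvar ` {1..\<alpha> + \<alpha>}" and ?c = "n + int \<alpha>"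
  have gen: "generic qq ?S" by (rule generic_xvar) simp
  then have S: "finite ?S" "0 \<notin> ?S" by (simp_all add: generic_def)
  have card: "card ?S = 2 * \<alpha>" by (simp add: card_image inj_on_subset[OF inj_xvar])
  \<comment> \<open>Ensures that the truncated \<open>\<alpha> - 1\<close> is a genuine difference,
    so that all three products use the same \<open>2 * \<alpha>\<close> variables. Adding the
    opposite sizes then gives the exponent pairs (1, -1), (0, 0) and (-1, 1), each shifted by
    \<open>?c\<close>.\<close>
  have \<alpha>: "\<alpha> \<ge> 1" using assms by simp
  have "star \<alpha> \<alpha> (xpow \<alpha> (n + 1)) (xpow \<alpha> (n - 1)) = subset_sum qq ?S \<alpha> (1 + ?c) (- 1 + ?c)"
    "star \<alpha> \<alpha> (xpow \<alpha> n) (xpow \<alpha> n) = subset_sum qq ?S \<alpha> (0 + ?c) (0 + ?c)"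
    "star (\<alpha> + 1) (\<alpha> - 1) (xpow (\<alpha> + 1) n) (xpow (\<alpha> - 1) n) =
      subset_sum qq ?S (Suc \<alpha>) (- 1 + ?c) (1 + ?c)"
    using \<alpha> by (simp_all add: star_xpow algebra_simps)
  then have T: "star \<alpha> \<alpha> (xpow \<alpha> (n + 1)) (xpow \<alpha> (n - 1)) = \<Prod>?S powi ?c * subset_sum qq ?S \<alpha> 1 (- 1)"
    "star \<alpha> \<alpha> (xpow \<alpha> n) (xpow \<alpha> n) = \<Prod>?S powi ?c * subset_sum qq ?S \<alpha> 0 0"
    "star (\<alpha> + 1) (\<alpha> - 1) (xpow (\<alpha> + 1) n) (xpow (\<alpha> - 1) n) =
      \<Prod>?S powi ?c * subset_sum qq ?S (Suc \<alpha>) (- 1) 1"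
    by (simp_all only: subset_sum_shift[OF S])
  show "qq ^ \<alpha> * star \<alpha> \<alpha> (xpow \<alpha> (n + 1)) (xpow \<alpha> (n - 1)) =
      star \<alpha> \<alpha> (xpow \<alpha> n) (xpow \<alpha> n) - star (\<alpha> + 1) (\<alpha> - 1) (xpow (\<alpha> + 1) n) (xpow (\<alpha> - 1) n)"
    unfolding T subset_sum_balanced[OF gen card, symmetric] by (simp add: algebra_simps)
qed

end
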